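(* Let $p(\cdot;\theta)$ be the density of $\mathcal N(\theta,\Sigma)$ on $\mathbb R^D$ with known $\Sigma$, and let $\mu_{prop}(d\theta')$ be any distribution on $\Theta$ symmetrical around $\hat\theta$. For $\theta\in\Theta^*(\delta_{\hat\theta})$ define $Y_\theta=(\theta-\hat\theta)^\intercal\Sigma^{-1}(\theta'-\hat\theta)$ with $\theta'\sim\mu_{prop}(d\theta')$. Suppose there exists an integrable random variable $Y$ under the measure $\mu_{prop}$ such that $e^{2Y_\theta}\le Y$ for all $\theta\in\Theta^*(\delta_{\hat\theta})$. If, for each $\theta\in\Theta^*(\delta_{\hat\theta})$, it is not the case that $Y_\theta=0$ with probability $1$, then $$\sup_{\theta\in\Theta^*(\delta_{\hat\theta})}\int_{\mathcal Y}\frac{(p(y;\theta))^2\int_\Theta p(y;\theta')(\delta_{\hat\theta}-\mu_{prop})(d\theta')}{p(y;\hat\theta)^2}\,dy<0,$$ and the mixture distribution produced by $\mu_{prop}$ results in a descent direction on $\mathcal D_{data}(\mathbb P_{\hat\theta})$, i.e. the function $t\mapsto l((1-t)\delta_{\hat\theta}+t\mu_{prop})$ has a strictly negative right derivative at $t=0$.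
   Context: $D,n\ge1$ are integers, $\alpha\in(0,1)$, $\chi^2_{1-\alpha,D}$ is the $1-\alpha$ quantile of the $\chi^2$-distribution with $D$ degrees of freedom, $\Sigma$ is a fixed symmetric positive definite $D\times D$ matrix, $\Theta\subset\mathbb R^D$ is an open convex set, $\hat\theta\in\Theta$ is fixed (the MLE), $\mathcal Y=\mathbb R^D$, $\mathbb P_\theta=\mathcal N(\theta,\Sigma)$. $\delta_{\hat\theta}$ is the point mass at $\hat\theta$. With $\chi^2(\mathbb P_1,\mathbb P_2)=\int(\frac{d\mathbb P_2}{d\mathbb P_1}-1)^2d\mathbb P_1$, $$\mathcal U_{data}=\Big\{\theta\in\Theta:\chi^2(\mathbb P_{\hat\theta},\mathbb P_\theta)\le\tfrac{\chi^2_{1-\alpha,D}}n\Big\}=\Big\{\hat\theta+\Sigma^{1/2}v:\ \|v\|_2^2\le\log\big(1+\tfrac{\chi^2_{1-\alpha,D}}n\big)\Big\}$$ (the ellipsoid being contained in $\Theta$). For a probability measure $\mu$ on $\Theta$, $$L(\mu,\theta)=\int_{\mathcal Y}\frac{(p(y;\theta))^2}{\int_\Theta p(y;\theta')\mu(d\theta')}dy,\quad l(\mu)=\sup_{\theta\in\mathcal U_{data}}L(\mu,\theta),\quad\Theta^*(\mu)=\operatorname{argmax}_{\theta\in\mathcal U_{data}}L(\mu,\theta);$$ in particular $\Theta^*(\delta_{\hat\theta})=\{\hat\theta+\Sigma^{1/2}v:\|v\|_2^2=\log(1+\chi^2_{1-\alpha,D}/n)\}$. For $\mathbb P_0$ with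 density $\int_\Theta p(y;\theta')\mu(d\theta')$, $\mathcal D_{data}(\mathbb P_0)=\sup_{\theta\in\mathcal U_{data}}\chi^2(\mathbb P_0,\mathbb P_\theta)=l(\mu)-1$. A distribution on $\Theta$ is called symmetrical around $\theta\in\Theta$ if its probability density or mass function has the same value at any $\theta_1,\theta_2\in\Theta$ with $\theta=\frac{\theta_1+\theta_2}2$.
   Formalization: "Symmetrical around θ̂" is required of the density or mass function extended by zero outside Θ, for all mirror pairs in R^D and not only pairs with both points in Θ; without this a point mass whose mirror image lies outside Θ is a counterexample. *)

theory Defs
  imports "HOL-Probability.Probability"
begin

definition sym_posdef :: "real^'d^'d \<Rightarrow> bool" where
  "sym_posdef A \<longleftrightarrow> transpose A = A \<and> (\<forall>x. x \<noteq> 0 \<longrightarrow> 0 < x \<bullet> (A *v x))"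

definition sym_possemidef :: "real^'d^'d \<Rightarrow> bool" where
  "sym_possemidef A \<longleftrightarrow> transpose A = A \<and> (\<forall>x. 0 \<le> x \<bullet> (A *v x))"

definition matrix_sqrt :: "real^'d^'d \<Rightarrow> real^'d^'d" where
  "matrix_sqrt A = (THE S. sym_possemidef S \<and> S ** S = A)"

definition chi_square_density :: "nat \<Rightarrow> real \<Rightarrow> real" where
  "chi_square_density k x =
     (if x \<le> 0 then 0
      else x powr (real k / 2 - 1) * exp (- x / 2) / (2 powr (real k / 2) * Gamma (real k / 2)))"

definition chi_square_quantile :: "nat \<Rightarrow> real \<Rightarrow> real" where
  "chi_square_quantile k p = Inf {x. p \<le> cdf (density lborel (\<lambda>x. ennreal (chi_square_density k x))) x}"

definition mvn_density :: "real^'d^'d \<Rightarrow> real^'d \<Rightarrow> real^'d \<Rightarrow> real" where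
  "mvn_density \<Sigma> \<theta> y =
     exp (- ((y - \<theta>) \<bullet> (matrix_inv \<Sigma> *v (y - \<theta>))) / 2) / sqrt ((2 * pi) ^ CARD('d) * det \<Sigma>)"

definition mvn :: "real^'d^'d \<Rightarrow> real^'d \<Rightarrow> (real^'d) measure" where
  "mvn \<Sigma> \<theta> = density lborel (\<lambda>y. ennreal (mvn_density \<Sigma> \<theta> y))"

definition chi2_div :: "'a measure \<Rightarrow> 'a measure \<Rightarrow> ennreal" where
  "chi2_div P1 P2 =
     (if absolutely_continuous P1 P2
      then \<integral>\<^sup>+ y. ennreal ((enn2real (RN_deriv P1 P2 y) - 1)\<^sup>2) \<partial>P1
      else \<infinity>)"

definition U_data :: "real \<Rightarrow> nat \<Rightarrow> (real^'d) set \<Rightarrow> real^'d^'d \<Rightarrow> real^'d \<Rightarrow> (real^'d) set" where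
  "U_data \<alpha> n \<Theta> \<Sigma> \<theta>h =
     {\<theta>\<in>\<Theta>. chi2_div (mvn \<Sigma> \<theta>h) (mvn \<Sigma> \<theta>) \<le> ennreal (chi_square_quantile CARD('d) (1 - \<alpha>) / real n)}"

definition confidence_ellipsoid :: "real \<Rightarrow> nat \<Rightarrow> real^'d^'d \<Rightarrow> real^'d \<Rightarrow> (real^'d) set" where
  "confidence_ellipsoid \<alpha> n \<Sigma> \<theta>h =
     {\<theta>h + matrix_sqrt \<Sigma> *v v | v.
        (norm v)\<^sup>2 \<le> ln (1 + chi_square_quantile CARD('d) (1 - \<alpha>) / real n)}"

text \<open>A distribution on \<open>\<Theta>\<close> is encoded as a Borel probability measure on the whole space that
  gives \<open>\<Theta>\<close> full mass.\<close>

definition distribution_on :: "(real^'d) set \<Rightarrow> (real^'d) measure \<Rightarrow> bool" where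
  "distribution_on \<Theta> \<mu> \<longleftrightarrow> prob_space \<mu> \<and> sets \<mu> = sets borel \<and> (AE \<theta> in \<mu>. \<theta> \<in> \<Theta>)"

text \<open>A density or mass function on \<open>\<Theta>\<close> is extended by zero outside \<open>\<Theta>\<close>, and the symmetry is
  required for the extension: a point of \<open>\<Theta>\<close> whose mirror image lies outside \<open>\<Theta>\<close> carries no
  density or mass. In the discrete case the mass function is \<open>\<theta> \<mapsto> measure \<mu> {\<theta>}\<close>.\<close>

definition symmetrical_around ::
    "(real^'d) set \<Rightarrow> (real^'d) measure \<Rightarrow> real^'d \<Rightarrow> bool" where
  "symmetrical_around \<Theta> \<mu> c \<longleftrightarrow>
     (\<exists>f :: real^'d \<Rightarrow> real. f \<in> borel_measurable borel \<and> (\<forall>x. 0 \<le> f x) \<and> (\<forall>x. x \<notin> \<Theta> \<longrightarrow> f x = 0) \<and>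
        \<mu> = density lborel (\<lambda>x. ennreal (f x)) \<and>
        (\<forall>\<theta>1 \<theta>2. c = (1/2) *\<^sub>R (\<theta>1 + \<theta>2) \<longrightarrow> f \<theta>1 = f \<theta>2)) \<or>
     ((\<exists>S. countable S \<and> S \<subseteq> \<Theta> \<and> (AE \<theta> in \<mu>. \<theta> \<in> S)) \<and>
        (\<forall>\<theta>1 \<theta>2. c = (1/2) *\<^sub>R (\<theta>1 + \<theta>2) \<longrightarrow> measure \<mu> {\<theta>1} = measure \<mu> {\<theta>2}))"

definition mix_measure :: "real \<Rightarrow> 'a measure \<Rightarrow> 'a measure \<Rightarrow> 'a measure" where
  "mix_measure t M N =
     measure_of (space M) (sets M) (\<lambda>A. ennreal (1 - t) * emeasure M A + ennreal t * emeasure N A)"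

text \<open>The functionals \<open>L\<close> and \<open>l\<close> take values in \<open>[0, \<infinity>]\<close>.\<close>

definition L_fun :: "(real^'d) set \<Rightarrow> real^'d^'d \<Rightarrow> (real^'d) measure \<Rightarrow> real^'d \<Rightarrow> ennreal" where
  "L_fun \<Theta> \<Sigma> \<mu> \<theta> =
     (\<integral>\<^sup>+ y. ennreal ((mvn_density \<Sigma> \<theta> y)\<^sup>2)
        / (\<integral>\<^sup>+ \<theta>' \<in> \<Theta>. ennreal (mvn_density \<Sigma> \<theta>' y) \<partial>\<mu>) \<partial>lborel)"

definition l_fun ::
    "real \<Rightarrow> nat \<Rightarrow> (real^'d) set \<Rightarrow> real^'d^'d \<Rightarrow> real^'d \<Rightarrow> (real^'d) measure \<Rightarrow> ennreal" where
  "l_fun \<alpha> n \<Theta> \<Sigma> \<theta>h \<mu> = (SUP \<theta> \<in> U_data \<alpha> n \<Theta> \<Sigma> \<theta>h. L_fun \<Theta> \<Sigma> \<mu> \<theta>)"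

definition Theta_star ::
    "real \<Rightarrow> nat \<Rightarrow> (real^'d) set \<Rightarrow> real^'d^'d \<Rightarrow> real^'d \<Rightarrow> (real^'d) measure \<Rightarrow> (real^'d) set" where
  "Theta_star \<alpha> n \<Theta> \<Sigma> \<theta>h \<mu> =
     {\<theta>. is_arg_max (L_fun \<Theta> \<Sigma> \<mu>) (\<lambda>\<theta>. \<theta> \<in> U_data \<alpha> n \<Theta> \<Sigma> \<theta>h) \<theta>}"

definition Y_var :: "real^'d^'d \<Rightarrow> real^'d \<Rightarrow> real^'d \<Rightarrow> real^'d \<Rightarrow> real" where
  "Y_var \<Sigma> \<theta>h \<theta> \<theta>' = (\<theta> - \<theta>h) \<bullet> (matrix_inv \<Sigma> *v (\<theta>' - \<theta>h))"

end

theory Submission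
  imports Defs
begin

text \<open>Write \<open>q u = (u - h)\<^sup>T \<Sigma>\<^sup>-\<^sup>1 (u - h)\<close> for the centre \<open>h\<close>. Completing the square gives
  \<open>(p u)\<^sup>2 p v / (p h)\<^sup>2 = exp (q u + 2 (u - h)\<^sup>T \<Sigma>\<^sup>-\<^sup>1 (v - h))\<close> times a Gaussian density. Hence
  \<open>L \<delta> u = exp (q u)\<close>, the maximisers form the sphere \<open>q u = \<rho>\<close>, and the directional derivative at such
  a \<open>u\<close> is \<open>exp \<rho> (1 - E (exp (2 Y)))\<close>, which is negative since \<open>Y\<close> is symmetric and not almost
  surely \<open>0\<close>. Domination makes \<open>u \<mapsto> E (exp (2 Y))\<close> continuous on the sphere, so the supremum is
  attained and negative. A Danskin argument turns this into the right derivative of \<open>l\<close>: the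
  tangent at a maximiser bounds \<open>l\<close> from below, and convexity in \<open>t\<close> with compactness of the
  ellipsoid bounds it from above.\<close>

section \<open>Orthonormal eigenbases and matrix square roots\<close>

text \<open>The exponential moment \<open>E u\<close> is controlled only for u on the maximising
  sphere, while the supremum defining \<open>l_fun\<close> runs over the whole ellipsoid. Points off
  the sphere are therefore never differentiated: there \<open>F 0 u\<close> lies strictly below the
  maximum, and the crude bound \<open>F t u \<le> exp (q u) / (1 - t)\<close>, valid for every
  mixing measure because the point mass alone bounds the denominator from below, leaves room for
  small t. Compactness is needed only to make "small" uniform in u. The spectral theorem enters for
  two reasons: \<open>matrix_sqrt\<close> is a definite description and carries no information
  before its root is known to exist uniquely, and the constant in \<open>mvn_density\<close> is
  written with \<open>det \<Sigma>\<close>, which must be matched with the actual Gaussian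
  integral.\<close>

lemma selfadjoint_eigenvector:
  fixes f :: "'a::euclidean_space \<Rightarrow> 'a"
  assumes f: "linear f" and sa: "\<And>x y. x \<bullet> f y = f x \<bullet> y"
    and V: "subspace V" and inv: "f ` V \<subseteq> V" and ne: "V \<noteq> {0}"
  obtains x c where "x \<in> V" "norm x = 1" "f x = c *\<^sub>R x"
proof -
  let ?K = "V \<inter> sphere 0 1"
  obtain v where v: "v \<in> V" "v \<noteq> 0"
    using ne V subspace_0 by blast
  then have "(1 / norm v) *\<^sub>R v \<in> ?K"
    using V by (simp add: subspace_scale)
  then have Kne: "?K \<noteq> {}" by blast
  have K: "compact ?K"
    using closed_subspace[OF V] by (simp add: closed_Int_compact)
  have "continuous_on ?K (\<lambda>x. x \<bullet> f x)"
    by (intro continuous_on_inner continuous_on_id linear_continuous_on)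
      (simp add: f linear_conv_bounded_linear[symmetric])
  \<comment> \<open>A maximiser of the Rayleigh quotient; its value will be the eigenvalue.\<close>
  then obtain x where x: "x \<in> ?K" and mx: "\<And>y. y \<in> ?K \<Longrightarrow> y \<bullet> f y \<le> x \<bullet> f x"
    using continuous_attains_sup[OF K Kne] by blast
  define c where "c = x \<bullet> f x"
  have le: "z \<bullet> f z \<le> c * (z \<bullet> z)" if "z \<in> V" for z
  proof (cases "z = 0")
    case True
    then show ?thesis by simp
  next
    case False
    have "(1 / norm z) *\<^sub>R z \<in> ?K"
      using False V that by (simp add: subspace_scale)
    from mx[OF this] have "(z \<bullet> f z) / (norm z)\<^sup>2 \<le> c"
      by (simp add: c_def linear_scale[OF f] power2_eq_square)
    then show ?thesis
      using False by (simp add: divide_simps power2_norm_eq_inner)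
  qed
  define g where "g = (\<lambda>z. c *\<^sub>R z - f z)"
  have xx: "x \<bullet> x = 1" using x by (simp add: norm_eq_1)
  have "f x \<in> V" using inv x by blast
  then have gV: "g x \<in> V" unfolding g_def
    using V x by (simp add: subspace_diff subspace_scale)
  \<comment> \<open>\<open>g\<close> is positive semidefinite on \<open>V\<close> and vanishes as a
    quadratic form at x. Moving from x along \<open>- g x\<close> gives a nonnegative quadratic in t
    whose linear coefficient is negative unless \<open>g x = 0\<close>.\<close>
  have "0 \<le> - 2 * t * (g x \<bullet> g x) + t\<^sup>2 * (g x \<bullet> g (g x))" for t
  proof -
    define y where "y = g x"
    have "x - t *\<^sub>R y \<in> V"
      using V x gV unfolding y_def by (simp add: subspace_diff subspace_scale)
    from le[OF this] have "0 \<le> (x - t *\<^sub>R y) \<bullet> (c *\<^sub>R (x - t *\<^sub>R y) - f (x - t *\<^sub>R y))"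
      by (simp add: inner_diff_right)
    also have "\<dots> = (c * (x \<bullet> x) - x \<bullet> f x) - 2 * t * (y \<bullet> (c *\<^sub>R x - f x)) + t\<^sup>2 * (y \<bullet> (c *\<^sub>R y - f y))"
      using sa[of x y]
      by (simp add: linear_diff[OF f] linear_scale[OF f] inner_diff_left inner_diff_right
        algebra_simps power2_eq_square inner_commute)
    also have "\<dots> = - 2 * t * (y \<bullet> y) + t\<^sup>2 * (y \<bullet> g y)"
      by (simp add: xx c_def[symmetric]) (simp add: y_def g_def)
    finally show ?thesis by (simp add: y_def)
  qed
  note quad = this
  have "g x \<bullet> g x = 0"
  proof (rule ccontr)
    assume "g x \<bullet> g x \<noteq> 0"
    then have p: "g x \<bullet> g x > 0" by simp
    define b where "b = \<bar>g x \<bullet> g (g x)\<bar> + 1"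
    \<comment> \<open>With this t the quadratic term is at most half the size of the linear
      one.\<close>
    define t where "t = (g x \<bullet> g x) / b"
    have b: "b > 0" "g x \<bullet> g (g x) \<le> b" by (auto simp: b_def)
    have t: "t > 0" using p b by (simp add: t_def)
    have "2 * t * (g x \<bullet> g x) \<le> t\<^sup>2 * b"
      using quad[of t] mult_left_mono[OF b(2), of "t\<^sup>2"] by simp
    also have "\<dots> = t * (g x \<bullet> g x)"
      using b by (simp add: t_def power2_eq_square)
    finally show False using t p by (simp add: zero_less_mult_iff)
  qed
  then have "f x = c *\<^sub>R x" by (simp add: g_def)
  then show thesis using that x by auto
qed

text \<open>Self-adjointness makes the orthogonal complement of an eigenvector invariant again, so
  induction on the dimension applies; this is why the statement speaks of invariant
  subspaces.\<close>

lemma selfadjoint_orthonormal_eigenbasis_subspace: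
  fixes f :: "'a::euclidean_space \<Rightarrow> 'a"
  assumes f: "linear f" and sa: "\<And>x y. x \<bullet> f y = f x \<bullet> y"
    and V: "subspace V" and inv: "f ` V \<subseteq> V"
  shows "\<exists>B. B \<subseteq> V \<and> pairwise orthogonal B \<and> (\<forall>b\<in>B. norm b = 1 \<and> (\<exists>c. f b = c *\<^sub>R b)) \<and> V \<subseteq> span B"
  using V inv
proof (induction "dim V" arbitrary: V rule: less_induct)
  case less
  show ?case
  proof (cases "V = {0}")
    case True
    then show ?thesis by (intro exI[of _ "{}"]) auto
  next
    case False
    obtain x c where x: "x \<in> V" "norm x = 1" "f x = c *\<^sub>R x"
      using selfadjoint_eigenvector[OF f sa less.prems False] by blast
    define W where "W = {v\<in>V. x \<bullet> v = 0}"
    have W: "subspace W"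
      using less.prems(1) unfolding W_def subspace_def by (auto simp: inner_add_right)
    have "f ` W \<subseteq> W"
    proof safe
      fix v assume "v \<in> W"
      moreover have "x \<bullet> f v = c * (x \<bullet> v)" using sa[of x v] x(3) by simp
      ultimately show "f v \<in> W" using less.prems(2) by (auto simp: W_def)
    qed
    moreover have "dim W < dim V"
    proof (rule dim_psubset)
      have "x \<notin> W" using x(2) by (simp add: W_def norm_eq_1)
      then have "W \<subset> V" using x(1) unfolding W_def by blast
      then show "span W \<subset> span V" using W less.prems(1) by (metis span_eq_iff)
    qed
    ultimately obtain B where B: "B \<subseteq> W" "pairwise orthogonal B"
        "\<forall>b\<in>B. norm b = 1 \<and> (\<exists>c. f b = c *\<^sub>R b)" "W \<subseteq> span B"
      using less.hyps[OF _ W] by blast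
    have "V \<subseteq> span (insert x B)"
    proof
      fix v assume v: "v \<in> V"
      have "v - (x \<bullet> v) *\<^sub>R x \<in> W"
        using v x less.prems(1) by (simp add: W_def subspace_diff subspace_scale inner_diff_right norm_eq_1)
      then have "v - (x \<bullet> v) *\<^sub>R x \<in> span B" using B(4) by blast
      then show "v \<in> span (insert x B)" by (auto simp: span_insert)
    qed
    moreover have "pairwise orthogonal (insert x B)"
      using B(1,2) unfolding pairwise_insert
      by (auto simp: W_def orthogonal_def inner_commute)
    ultimately show ?thesis
      using B x by (intro exI[of _ "insert x B"]) (auto simp: W_def)
  qed
qed

text \<open>An orthonormal spanning set has exactly \<open>CARD('n)\<close> elements, so the
  eigenvectors can be indexed by the coordinates themselves and become the columns of a square
  matrix.\<close>

lemma symmetric_matrix_orthonormal_eigenbasis: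
  fixes A :: "real^'n^'n"
  assumes A: "transpose A = A"
  obtains e :: "'n \<Rightarrow> real^'n" and c :: "'n \<Rightarrow> real"
    where "\<And>i j. e i \<bullet> e j = (if i = j then 1 else 0)" "\<And>i. A *v e i = c i *\<^sub>R e i"
proof -
  have sa: "x \<bullet> (A *v y) = (A *v x) \<bullet> y" for x y
    by (metis A dot_lmul_matrix vector_transpose_matrix)
  obtain B where B: "pairwise orthogonal B" "\<forall>b\<in>B. norm b = 1 \<and> (\<exists>c. A *v b = c *\<^sub>R b)"
      "UNIV \<subseteq> span B"
    using selfadjoint_orthonormal_eigenbasis_subspace[of "(*v) A" UNIV] sa by auto
  have "independent B"
    using B by (intro pairwise_orthogonal_independent) auto
  then have "card B = CARD('n)" "finite B"
    using B(3) dim_eq_card[of B UNIV] independent_imp_finite by (auto simp: top.extremum_unique)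
  then obtain e where e: "bij_betw e (UNIV :: 'n set) B"
    by (metis bij_betw_iff_card finite)
  have eB: "e i \<in> B" for i using e by (auto simp: bij_betw_def)
  have ij: "e i \<bullet> e j = (if i = j then 1 else 0)" for i j
  proof (cases "i = j")
    case True
    then show ?thesis using B(2) eB by (auto simp: norm_eq_1)
  next
    case False
    then have "e i \<noteq> e j" using e by (auto simp: bij_betw_def inj_on_def)
    then show ?thesis using B(1) eB False by (auto simp: pairwise_def orthogonal_def)
  qed
  have "\<forall>i. \<exists>c. A *v e i = c *\<^sub>R e i" using B(2) eB by blast
  then obtain c where "\<And>i. A *v e i = c i *\<^sub>R e i" by metis
  with ij show thesis using that by blast
qed

locale orthonormal_basis =
  fixes e :: "'n::finite \<Rightarrow> real^'n"
  assumes orthonormal: "e i \<bullet> e j = (if i = j then 1 else 0)"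
begin

definition P :: "real^'n^'n" where "P = (\<chi> i j. e j $ i)"

lemma P_mult: "P *v x = (\<Sum>i\<in>UNIV. (x $ i) *\<^sub>R e i)"
  by (simp add: P_def matrix_vector_mult_def vec_eq_iff mult.commute)

lemma transpose_P_component: "(transpose P *v y) $ i = e i \<bullet> y"
  by (simp add: P_def transpose_def matrix_vector_mult_def inner_vec_def)

lemma orthogonal_P: "orthogonal_matrix P"
  unfolding orthogonal_matrix
  by (simp add: P_def transpose_def matrix_matrix_mult_def mat_def vec_eq_iff
      orthonormal[unfolded inner_vec_def, simplified])

lemma P_inverse: "transpose P *v (P *v x) = x" "P *v (transpose P *v x) = x"
  using orthogonal_P unfolding orthogonal_matrix_def by (auto simp only: matrix_vector_mul_assoc matrix_vector_mul_lid)

text \<open>Completeness follows from orthonormality alone: \<open>P\<close> is square, so its left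
  inverse \<open>transpose P\<close> is also a right inverse.\<close>

lemma expansion: "x = (\<Sum>i\<in>UNIV. (e i \<bullet> x) *\<^sub>R e i)"
  by (rule P_inverse(2)[of x, unfolded P_mult transpose_P_component, symmetric])

lemma matrix_eqI:
  assumes "\<And>i. A *v e i = B *v e i"
  shows "A = (B :: real^'n^'n)"
proof -
  have "A *v (\<Sum>i\<in>UNIV. (e i \<bullet> x) *\<^sub>R e i) = B *v (\<Sum>i\<in>UNIV. (e i \<bullet> x) *\<^sub>R e i)" for x
    by (simp add: linear_sum[OF matrix_vector_mul_linear] linear_scale[OF matrix_vector_mul_linear] assms)
  then have "A *v x = B *v x" for x
    unfolding expansion[symmetric] .
  then show ?thesis by (simp add: matrix_eq)
qed

text \<open>\<open>A ** P = P ** D\<close> with \<open>D\<close> diagonal; the nonzero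
  \<open>det P\<close> cancels.\<close>

lemma det_eigenvalues:
  assumes "\<And>i. A *v e i = c i *\<^sub>R e i"
  shows "det A = (\<Prod>i\<in>UNIV. c i)"
proof -
  have AP: "A ** P = P ** (\<chi> i j. if i = j then c i else 0)" (is "_ = _ ** ?D")
  proof -
    have "(?D *v x) $ i = c i * x $ i" for x i
      by (simp add: matrix_vector_mult_def if_distrib[of "\<lambda>r. r * _"] cong: if_cong)
    then have "(A ** P) *v x = (P ** ?D) *v x" for x
      unfolding matrix_vector_mul_assoc[symmetric] P_mult linear_sum[OF matrix_vector_mul_linear]
          linear_scale[OF matrix_vector_mul_linear] assms
      by (simp add: mult.commute)
    then show ?thesis by (simp add: matrix_eq)
  qed
  have detD: "det ?D = (\<Prod>i\<in>UNIV. c i)"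
    by (subst det_diagonal) auto
  have "det A * det P = det P * (\<Prod>i\<in>UNIV. c i)"
    unfolding detD[symmetric] det_mul[symmetric] AP ..
  moreover have "det P \<noteq> 0"
    using det_orthogonal_matrix[OF orthogonal_P] by auto
  ultimately show ?thesis by simp
qed

end

text \<open>The spectral root gives existence. For uniqueness, any other root is compared with it on
  each eigenvector of \<open>\<Sigma>\<close>, where positivity of the eigenvalue rules out the
  negative sign.\<close>

lemma matrix_sqrt_exists:
  fixes \<Sigma> :: "real^'n^'n"
  assumes \<Sigma>: "sym_posdef \<Sigma>"
  shows "sym_possemidef (matrix_sqrt \<Sigma>) \<and> matrix_sqrt \<Sigma> ** matrix_sqrt \<Sigma> = \<Sigma>"
proof -
  obtain e :: "'n \<Rightarrow> real^'n" and c where e: "\<And>i j. e i \<bullet> e j = (if i = j then 1 else (0::real))"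
      and c: "\<And>i. \<Sigma> *v e i = c i *\<^sub>R e i"
    using symmetric_matrix_orthonormal_eigenbasis[of \<Sigma>] \<Sigma> unfolding sym_posdef_def by blast
  interpret orthonormal_basis e using e by unfold_locales
  have pos: "c i > 0" for i
  proof -
    have "e i \<noteq> 0" using e[of i i] by auto
    then show ?thesis using \<Sigma> c[of i] e[of i i] unfolding sym_posdef_def
      by (metis inner_scaleR_right mult.right_neutral)
  qed
  define S where "S = matrix (\<lambda>x. \<Sum>i\<in>UNIV. (sqrt (c i) * (e i \<bullet> x)) *\<^sub>R e i)"
  have Sx: "S *v x = (\<Sum>i\<in>UNIV. (sqrt (c i) * (e i \<bullet> x)) *\<^sub>R e i)" for x
  proof -
    have "linear (\<lambda>x. \<Sum>i\<in>UNIV. (sqrt (c i) * (e i \<bullet> x)) *\<^sub>R e i)"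
      by (auto intro!: linearI simp: algebra_simps sum.distrib scaleR_sum_right)
    from matrix_vector_mul(2)[OF this] show ?thesis unfolding S_def by metis
  qed
  have Se: "S *v e i = sqrt (c i) *\<^sub>R e i" for i
    by (simp add: Sx e if_distrib[of "\<lambda>r. (_ * r) *\<^sub>R _"] cong: if_cong)
  have inner: "x \<bullet> (S *v y) = (\<Sum>i\<in>UNIV. sqrt (c i) * (e i \<bullet> x) * (e i \<bullet> y))" for x y
    by (simp add: Sx inner_sum_right inner_commute mult_ac)
  have "transpose S = S"
  proof -
    have "x \<bullet> (transpose S *v y) = x \<bullet> (S *v y)" for x y
    proof -
      have "x \<bullet> (transpose S *v y) = y \<bullet> (S *v x)"
        by (metis dot_lmul_matrix inner_commute transpose_matrix_vector)
      then show ?thesis by (simp add: inner mult_ac)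
    qed
    then show ?thesis by (metis matrix_eq vector_eq_ldot)
  qed
  moreover have "0 \<le> x \<bullet> (S *v x)" for x
    unfolding inner using pos by (intro sum_nonneg) (simp add: mult.assoc less_imp_le)
  moreover have "S ** S = \<Sigma>"
    by (rule matrix_eqI) (simp add: matrix_vector_mul_assoc[symmetric] Se c
        linear_scale[OF matrix_vector_mul_linear] pos less_imp_le)
  ultimately have S: "sym_possemidef S \<and> S ** S = \<Sigma>"
    by (simp add: sym_possemidef_def)
  have "matrix_sqrt \<Sigma> = S"
    unfolding matrix_sqrt_def
  proof (rule the_equality)
    show "sym_possemidef S \<and> S ** S = \<Sigma>" by (rule S)
  next
    fix T assume T: "sym_possemidef T \<and> T ** T = \<Sigma>"
    show "T = S"
    proof (rule matrix_eqI)
      fix i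
      define s where "s = sqrt (c i)"
      have s: "s > 0" "s * s = c i" using pos[of i] by (auto simp: s_def)
      define w where "w = T *v e i - s *\<^sub>R e i"
      \<comment> \<open>\<open>(T + s)(T - s)\<close> annihilates \<open>e i\<close>, so \<open>w\<close> is an eigenvector of \<open>T\<close> for \<open>- s < 0\<close> or zero.\<close>
      have "T *v (T *v e i) = (s * s) *\<^sub>R e i"
        using T c[of i] s by (metis matrix_vector_mul_assoc)
      then have "T *v w = - s *\<^sub>R w"
        by (simp add: w_def matrix_vector_mult_diff_distrib linear_scale[OF matrix_vector_mul_linear]
            scaleR_diff_right)
      then have "- s * (w \<bullet> w) \<ge> 0"
        using T unfolding sym_possemidef_def by (metis inner_scaleR_right)
      then have "w \<bullet> w \<le> 0" using mult_le_cancel_left_pos[OF s(1), of "w \<bullet> w" 0] by simp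
      then have "w = 0" by (metis inner_eq_zero_iff inner_ge_zero order_antisym)
      then show "T *v e i = S *v e i" by (simp add: w_def Se s_def)
    qed
  qed
  then show ?thesis using S by simp
qed

section \<open>Gaussian integrals\<close>

lemma nn_integral_lborel_translate:
  fixes g :: "'a::euclidean_space \<Rightarrow> ennreal"
  assumes [measurable]: "g \<in> borel_measurable borel"
  shows "(\<integral>\<^sup>+x. g (t + x) \<partial>lborel) = (\<integral>\<^sup>+x. g x \<partial>lborel)"
  by (subst (2) lborel_distr_plus[of t, symmetric]) (simp add: nn_integral_distr)

text \<open>Translation invariance fixes Lebesgue measure up to a factor, and the unit ball shows
  that the factor is 1: it is unchanged by \<open>T\<close> and has positive finite measure, so
  \<open>c\<close> can be cancelled. The result serves both for rotating to an eigenbasis and for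
  reflecting at the centre.\<close>

lemma nn_integral_lborel_orthogonal_transformation:
  fixes g :: "'a::euclidean_space \<Rightarrow> ennreal" and T :: "'a \<Rightarrow> 'a"
  assumes T: "orthogonal_transformation T" and [measurable]: "g \<in> borel_measurable borel"
  shows "(\<integral>\<^sup>+x. g (T x) \<partial>lborel) = (\<integral>\<^sup>+x. g x \<partial>lborel)"
proof -
  have lin: "linear T" using T by (rule orthogonal_transformation_linear)
  have [measurable]: "T \<in> borel_measurable borel"
    by (intro borel_measurable_continuous_onI linear_continuous_on) (simp add: lin linear_conv_bounded_linear[symmetric])
  have nT: "norm (T x) = norm x" for x
    using T by (rule orthogonal_transformation_norm)
  have surj: "\<exists>z. T z = y" for y
  proof -
    have "inj T" unfolding linear_injective_0[OF lin] using nT by (metis norm_eq_zero)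
    then have "surj T" by (rule linear_injective_imp_surjective[OF lin]) simp
    then show ?thesis by (metis surjD)
  qed
  define b :: "'a \<Rightarrow> ennreal" where "b = indicator (ball 0 1)"
  have [measurable]: "b \<in> borel_measurable borel" unfolding b_def by (rule borel_measurable_indicator) simp
  define c where "c = (\<integral>\<^sup>+x. b x \<partial>lborel)"
  have c_eq: "c = emeasure lborel (ball (0::'a) 1)" by (simp add: c_def b_def)
  have c: "c \<noteq> 0" "c \<noteq> \<infinity>"
  proof -
    show "c \<noteq> \<infinity>" unfolding c_eq using emeasure_lborel_ball_finite[of "0::'a" 1] by auto
    show "c \<noteq> 0" unfolding c_eq
      using open_ball[of "0::'a" 1] emeasure_lborel_ball_finite[of "0::'a" 1]
        content_ball_pos[of 1 "0::'a"]
      by (auto simp: measure_def)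
  qed
  \<comment> \<open>Compute \<open>\<integral>\<integral> g y b (y - T x) dy dx\<close> in both orders.\<close>
  let ?I = "\<integral>\<^sup>+x. (\<integral>\<^sup>+y. g y * b (y - T x) \<partial>lborel) \<partial>lborel"
  have "?I = (\<integral>\<^sup>+x. (\<integral>\<^sup>+y. g (T x + y) * b y \<partial>lborel) \<partial>lborel)"
  proof (rule nn_integral_cong)
    fix x
    show "(\<integral>\<^sup>+y. g y * b (y - T x) \<partial>lborel) = (\<integral>\<^sup>+y. g (T x + y) * b y \<partial>lborel)"
      using nn_integral_lborel_translate[of "\<lambda>y. g y * b (y - T x)" "T x"] by simp
  qed
  also have "\<dots> = (\<integral>\<^sup>+y. (\<integral>\<^sup>+x. g (T x + y) * b y \<partial>lborel) \<partial>lborel)"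
    by (rule lborel_pair.Fubini') simp
  also have "\<dots> = (\<integral>\<^sup>+y. b y * (\<integral>\<^sup>+x. g (T x) \<partial>lborel) \<partial>lborel)"
  proof (rule nn_integral_cong)
    fix y
    obtain z where z: "T z = y" using surj by blast
    have "(\<integral>\<^sup>+x. g (T x + y) * b y \<partial>lborel) = (\<integral>\<^sup>+x. g (T x + y) \<partial>lborel) * b y"
      by (simp add: nn_integral_multc)
    also have "(\<integral>\<^sup>+x. g (T x + y) \<partial>lborel) = (\<integral>\<^sup>+x. g (T (z + x)) \<partial>lborel)"
      by (simp add: linear_add[OF lin] z add.commute)
    also have "\<dots> = (\<integral>\<^sup>+x. g (T x) \<partial>lborel)"
      by (rule nn_integral_lborel_translate) simp
    finally show "(\<integral>\<^sup>+x. g (T x + y) * b y \<partial>lborel) = b y * (\<integral>\<^sup>+x. g (T x) \<partial>lborel)"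
      by (simp add: mult.commute)
  qed
  also have "\<dots> = c * (\<integral>\<^sup>+x. g (T x) \<partial>lborel)"
    by (simp add: nn_integral_multc c_def)
  finally have 1: "?I = c * (\<integral>\<^sup>+x. g (T x) \<partial>lborel)" .
  have "?I = (\<integral>\<^sup>+y. (\<integral>\<^sup>+x. g y * b (y - T x) \<partial>lborel) \<partial>lborel)"
    by (rule lborel_pair.Fubini'[symmetric]) simp
  also have "\<dots> = (\<integral>\<^sup>+y. g y * c \<partial>lborel)"
  proof (rule nn_integral_cong)
    fix y
    obtain z where z: "T z = y" using surj by blast
    have "b (y - T x) = b (- z + x)" for x
    proof -
      have "y - T x = T (z - x)" by (simp add: z linear_diff[OF lin])
      then have "norm (y - T x) = norm (- z + x)" by (simp add: nT norm_minus_commute)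
      then show ?thesis by (simp add: b_def indicator_def)
    qed
    then have "(\<integral>\<^sup>+x. g y * b (y - T x) \<partial>lborel) = g y * (\<integral>\<^sup>+x. b (- z + x) \<partial>lborel)"
      by (simp add: nn_integral_cmult)
    then show "(\<integral>\<^sup>+x. g y * b (y - T x) \<partial>lborel) = g y * c"
      unfolding c_def by (subst (asm) nn_integral_lborel_translate) simp_all
  qed
  also have "\<dots> = c * (\<integral>\<^sup>+x. g x \<partial>lborel)"
    by (subst nn_integral_multc) (simp_all add: mult.commute)
  finally have "c * (\<integral>\<^sup>+x. g (T x) \<partial>lborel) = c * (\<integral>\<^sup>+x. g x \<partial>lborel)"
    using 1 by simp
  then show ?thesis
    using c by (simp add: ennreal_mult_cancel_left)
qed

lemma nn_integral_gaussian:
  assumes "0 < c"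
  shows "(\<integral>\<^sup>+x. ennreal (exp (- x\<^sup>2 / (2 * c))) \<partial>lborel) = ennreal (sqrt (2 * pi * c))"
proof -
  have "ennreal (exp (- x\<^sup>2 / (2 * c))) = ennreal (sqrt (2 * pi * c)) * ennreal (normal_density 0 (sqrt c) x)" for x
    using assms by (simp add: normal_density_def ennreal_mult[symmetric])
  moreover have "(\<integral>\<^sup>+x. ennreal (normal_density 0 (sqrt c) x) \<partial>lborel) = 1"
    using prob_space.emeasure_space_1[OF prob_space_normal_density[of "sqrt c" 0]] assms
    by (simp add: emeasure_density)
  ultimately show ?thesis by (simp add: nn_integral_cmult)
qed

lemma Basis_real_vec: "(Basis :: (real^'n) set) = range (\<lambda>i. axis i 1)"
  by (auto simp: Basis_vec_def)

lemma prod_Basis_real_vec: "(\<Prod>b\<in>(Basis :: (real^'n) set). f b) = (\<Prod>i\<in>UNIV. f (axis i 1))"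
  unfolding Basis_real_vec by (subst prod.reindex) (auto simp: inj_on_def axis_eq_axis)

section \<open>The inner product of the inverse covariance, its ellipsoids and its Gaussian
  integral\<close>

locale covariance_matrix =
  fixes \<Sigma> :: "real^'n^'n"
  assumes posdef: "sym_posdef \<Sigma>"
begin

text \<open>The Mahalanobis inner product; \<open>ip (x - c) (x - c)\<close> is the squared
  Mahalanobis distance from c.\<close>

definition ip :: "real^'n \<Rightarrow> real^'n \<Rightarrow> real" where
  "ip x y = x \<bullet> (matrix_inv \<Sigma> *v y)"

lemma invertible_\<Sigma>: "invertible \<Sigma>"
proof -
  have "x = 0" if "\<Sigma> *v x = 0" for x
    using posdef that unfolding sym_posdef_def by (metis inner_zero_right less_irrefl)
  then show ?thesis by (simp add: invertible_left_inverse matrix_left_invertible_ker)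
qed

lemma inv_mult: "matrix_inv \<Sigma> *v (\<Sigma> *v x) = x" "\<Sigma> *v (matrix_inv \<Sigma> *v x) = x"
proof -
  have "\<Sigma> ** matrix_inv \<Sigma> = mat 1 \<and> matrix_inv \<Sigma> ** \<Sigma> = mat 1"
    using invertible_\<Sigma> unfolding matrix_inv_def invertible_def by (rule someI_ex)
  then show "matrix_inv \<Sigma> *v (\<Sigma> *v x) = x" "\<Sigma> *v (matrix_inv \<Sigma> *v x) = x"
    by (simp_all add: matrix_vector_mul_assoc)
qed

lemma ip_commute: "ip x y = ip y x"
proof -
  have sym: "v \<bullet> (\<Sigma> *v w) = (\<Sigma> *v v) \<bullet> w" for v w
    using posdef unfolding sym_posdef_def by (metis dot_lmul_matrix vector_transpose_matrix)
  show ?thesis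
    unfolding ip_def using sym[of "matrix_inv \<Sigma> *v x" "matrix_inv \<Sigma> *v y"]
    by (simp add: inv_mult inner_commute)
qed

lemma ip_linear [simp]:
  "ip (x + y) z = ip x z + ip y z" "ip z (x + y) = ip z x + ip z y"
  "ip (x - y) z = ip x z - ip y z" "ip z (x - y) = ip z x - ip z y"
  "ip (r *\<^sub>R x) z = r * ip x z" "ip z (r *\<^sub>R x) = r * ip z x"
  "ip (- x) z = - ip x z" "ip z (- x) = - ip z x"
  "ip 0 z = 0" "ip z 0 = 0"
  by (simp_all add: ip_def inner_add_left inner_add_right inner_diff_left inner_diff_right
      linear_add[OF matrix_vector_mul_linear] linear_diff[OF matrix_vector_mul_linear]
      linear_scale[OF matrix_vector_mul_linear] linear_neg[OF matrix_vector_mul_linear])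

lemma ip_pos: "x \<noteq> 0 \<Longrightarrow> 0 < ip x x"
proof -
  assume "x \<noteq> 0"
  then have "matrix_inv \<Sigma> *v x \<noteq> 0" using inv_mult(2)[of x] by auto
  then have "0 < (matrix_inv \<Sigma> *v x) \<bullet> (\<Sigma> *v (matrix_inv \<Sigma> *v x))"
    using posdef unfolding sym_posdef_def by blast
  then show ?thesis by (simp add: inv_mult ip_def inner_commute)
qed

lemma ip_nonneg: "0 \<le> ip x x"
  using ip_pos[of x] by (cases "x = 0") auto

lemma ip_continuous [continuous_intros]:
  assumes "continuous_on S f" "continuous_on S g"
  shows "continuous_on S (\<lambda>x. ip (f x) (g x))"
  unfolding ip_def
  by (intro continuous_on_inner assms continuous_on_compose2[OF linear_continuous_on[OF matrix_vector_mul_bounded_linear] assms(2)]) auto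

lemma ip_measurable [measurable]:
  assumes [measurable]: "f \<in> borel_measurable M" "g \<in> borel_measurable M"
  shows "(\<lambda>x. ip (f x) (g x)) \<in> borel_measurable M"
proof -
  have [measurable]: "(*v) (matrix_inv \<Sigma>) \<in> borel_measurable borel"
    by (intro borel_measurable_continuous_onI linear_continuous_on matrix_vector_mul_bounded_linear)
  show ?thesis unfolding ip_def by simp
qed

lemma ellipsoid_eq:
  "{c + matrix_sqrt \<Sigma> *v v | v. (norm v)\<^sup>2 \<le> r} = {\<theta>. ip (\<theta> - c) (\<theta> - c) \<le> r}"
proof -
  define S where "S = matrix_sqrt \<Sigma>"
  have S: "S ** S = \<Sigma>" "transpose S = S"
    using matrix_sqrt_exists[OF posdef] by (auto simp: S_def sym_possemidef_def)
  have sym: "v \<bullet> (S *v w) = (S *v v) \<bullet> w" for v w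
    by (metis S(2) dot_lmul_matrix vector_transpose_matrix)
  have SS: "S *v (S *v x) = \<Sigma> *v x" for x by (simp add: matrix_vector_mul_assoc S)
  \<comment> \<open>The inverse of the root, expressed through the inverse of
    \<open>\<Sigma>\<close> so that \<open>S\<close> itself need not be inverted.\<close>
  define R where "R x = S *v (matrix_inv \<Sigma> *v x)" for x :: "real^'n"
  have SR: "S *v R x = x" for x by (simp add: R_def SS inv_mult)
  have nR: "(norm (R x))\<^sup>2 = ip x x" for x
    unfolding power2_norm_eq_inner R_def
    by (simp add: sym SS inv_mult) (simp add: ip_def inner_commute)
  have RS: "R (S *v v) = v" for v
  proof -
    have "(S *v u = S *v v) \<longrightarrow> u = v" for u
    proof
      assume "S *v u = S *v v"
      then have "\<Sigma> *v u = \<Sigma> *v v" by (metis SS)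
      then show "u = v" by (metis inv_mult(1))
    qed
    then show ?thesis using SR by blast
  qed
  show ?thesis unfolding S_def[symmetric]
  proof safe
    fix v :: "real^'n" assume "(norm v)\<^sup>2 \<le> r"
    then show "ip (c + S *v v - c) (c + S *v v - c) \<le> r"
      using nR[of "S *v v"] by (simp add: RS)
  next
    fix \<theta> :: "real^'n" assume "ip (\<theta> - c) (\<theta> - c) \<le> r"
    then show "\<exists>v. \<theta> = c + S *v v \<and> (norm v)\<^sup>2 \<le> r"
      by (intro exI[of _ "R (\<theta> - c)"]) (simp only: nR SR, simp)
  qed
qed

text \<open>For nonnegative r the set is an affine image of a closed ball, for negative r it is
  empty; no estimate of eigenvalues is involved.\<close>

lemma compact_ellipsoid: "compact {\<theta>. ip (\<theta> - c) (\<theta> - c) \<le> r}"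
proof (cases "0 \<le> r")
  case True
  have "{c + matrix_sqrt \<Sigma> *v v | v. (norm v)\<^sup>2 \<le> r} = (\<lambda>v. c + matrix_sqrt \<Sigma> *v v) ` cball 0 (sqrt r)"
  proof -
    have "(norm v)\<^sup>2 \<le> r \<longleftrightarrow> v \<in> cball 0 (sqrt r)" for v :: "real^'n"
      using real_sqrt_le_iff[of "(norm v)\<^sup>2" r] by simp
    then show ?thesis by (auto simp: image_def)
  qed
  moreover have "compact ((\<lambda>v. c + matrix_sqrt \<Sigma> *v v) ` cball 0 (sqrt r))"
    by (intro compact_continuous_image continuous_intros linear_continuous_on
        matrix_vector_mul_bounded_linear compact_cball)
  ultimately show ?thesis using ellipsoid_eq[of c r] by simp
next
  case False
  have "{\<theta>. ip (\<theta> - c) (\<theta> - c) \<le> r} = {}"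
    using False ip_nonneg by (auto simp del: ip_linear dest: order_trans[OF ip_nonneg])
  then show ?thesis by simp
qed

definition Z :: real where "Z = sqrt ((2 * pi) ^ CARD('n) * det \<Sigma>)"

text \<open>Rotation to an eigenbasis diagonalises the form, so the integral splits into
  one-dimensional Gaussians with the eigenvalues as variances; their product is \<open>Z\<close>
  because \<open>det \<Sigma>\<close> is the product of the eigenvalues.\<close>

lemma gaussian_integral:
  "0 < Z" "(\<integral>\<^sup>+x. ennreal (exp (- ip x x / 2)) \<partial>lborel) = ennreal Z"
proof -
  obtain e :: "'n \<Rightarrow> real^'n" and c where e: "\<And>i j. e i \<bullet> e j = (if i = j then 1 else (0::real))"
      and c: "\<And>i. \<Sigma> *v e i = c i *\<^sub>R e i"
    using symmetric_matrix_orthonormal_eigenbasis[of \<Sigma>] posdef unfolding sym_posdef_def by blast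
  interpret orthonormal_basis e using e by unfold_locales
  have pos: "c i > 0" for i
  proof -
    have "e i \<noteq> 0" using e[of i i] by auto
    then show ?thesis using posdef c[of i] e[of i i] unfolding sym_posdef_def
      by (metis inner_scaleR_right mult.right_neutral)
  qed
  have inv_e: "matrix_inv \<Sigma> *v e i = (1 / c i) *\<^sub>R e i" for i
  proof -
    have "matrix_inv \<Sigma> *v (c i *\<^sub>R e i) = e i" using inv_mult(1)[of "e i"] c by simp
    then have "c i *\<^sub>R (matrix_inv \<Sigma> *v e i) = e i"
      by (simp add: linear_scale[OF matrix_vector_mul_linear])
    then have "(1 / c i) *\<^sub>R c i *\<^sub>R (matrix_inv \<Sigma> *v e i) = (1 / c i) *\<^sub>R e i" by (rule arg_cong)
    then show ?thesis using pos[of i] by simp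
  qed
  have ipP: "ip (P *v x) (P *v x) = (\<Sum>i\<in>UNIV. (x $ i)\<^sup>2 / c i)" for x
  proof -
    have "matrix_inv \<Sigma> *v (P *v x) = (\<Sum>i\<in>UNIV. (x $ i / c i) *\<^sub>R e i)"
      unfolding P_mult
      by (simp add: linear_sum[OF matrix_vector_mul_linear] linear_scale[OF matrix_vector_mul_linear] inv_e)
    moreover have "e i \<bullet> (P *v x) = x $ i" for i
      by (simp add: P_mult inner_sum_right e if_distrib cong: if_cong)
    ultimately show ?thesis
      by (simp add: ip_def inner_sum_right inner_commute power2_eq_square)
  qed
  have det: "det \<Sigma> = (\<Prod>i\<in>UNIV. c i)" using c by (rule det_eigenvalues)
  have sqrt_prod: "sqrt (\<Prod>i\<in>I. f i) = (\<Prod>i\<in>I. sqrt (f i))" if "finite I" for f and I :: "'n set"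
    using that by induction (auto simp: real_sqrt_mult)
  have Z: "Z = (\<Prod>i\<in>UNIV. sqrt (2 * pi * c i))"
    by (simp add: Z_def det sqrt_prod power_mult_distrib prod.distrib real_sqrt_mult real_sqrt_power)
  show "0 < Z" unfolding Z by (intro prod_pos) (simp add: pos)
  \<comment> \<open>The product formula for \<open>lborel\<close> runs over \<open>Basis\<close>
    rather than over indices; \<open>c'\<close> carries the eigenvalues to the basis
    vectors.\<close>
  define c' where "c' b = (\<Sum>i\<in>UNIV. c i * b $ i)" for b :: "real^'n"
  have c'_axis: "c' (axis i 1) = c i" for i
    by (simp add: c'_def axis_def if_distrib cong: if_cong)
  have orth: "orthogonal_transformation ((*v) P)"
    using orthogonal_P by (simp add: orthogonal_transformation_matrix)
  have "(\<integral>\<^sup>+x. ennreal (exp (- ip x x / 2)) \<partial>lborel) = (\<integral>\<^sup>+x. ennreal (exp (- ip (P *v x) (P *v x) / 2)) \<partial>lborel)"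
    by (rule nn_integral_lborel_orthogonal_transformation[OF orth, symmetric]) simp
  also have "\<dots> = (\<integral>\<^sup>+x. (\<Prod>b\<in>Basis. ennreal (exp (- (x \<bullet> b)\<^sup>2 / (2 * c' b)))) \<partial>lborel)"
  proof (rule nn_integral_cong)
    fix x :: "real^'n"
    have "- (\<Sum>i\<in>UNIV. (x $ i)\<^sup>2 / c i) / 2 = (\<Sum>i\<in>UNIV. - (x $ i)\<^sup>2 / (2 * c i))"
      by (simp add: sum_negf sum_divide_distrib mult.commute)
    then show "ennreal (exp (- ip (P *v x) (P *v x) / 2)) = (\<Prod>b\<in>Basis. ennreal (exp (- (x \<bullet> b)\<^sup>2 / (2 * c' b))))"
      unfolding prod_Basis_real_vec c'_axis ipP
      by (simp add: exp_sum prod_ennreal cart_eq_inner_axis)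
  qed
  also have "\<dots> = (\<Prod>b\<in>Basis. (\<integral>\<^sup>+x. ennreal (exp (- x\<^sup>2 / (2 * c' b))) \<partial>lborel))"
    by (rule nn_integral_lborel_prod) auto
  also have "\<dots> = ennreal Z"
    unfolding prod_Basis_real_vec c'_axis Z
    by (simp only: nn_integral_gaussian[OF pos]) (simp add: prod_ennreal pos less_imp_le)
  finally show "(\<integral>\<^sup>+x. ennreal (exp (- ip x x / 2)) \<partial>lborel) = ennreal Z" .
qed

section \<open>Gaussian densities and their products\<close>

abbreviation p :: "real^'n \<Rightarrow> real^'n \<Rightarrow> real" where "p \<equiv> mvn_density \<Sigma>"

lemma p_eq: "p \<theta> y = exp (- ip (y - \<theta>) (y - \<theta>) / 2) / Z"
  by (simp add: mvn_density_def ip_def Z_def)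

lemma p_pos [simp]: "0 < p \<theta> y"
  by (simp only: p_eq) (simp add: gaussian_integral)

lemma p_nonneg [simp]: "0 \<le> p \<theta> y" and p_nonzero [simp]: "p \<theta> y \<noteq> 0"
  using p_pos[of \<theta> y] by linarith+

lemma p_measurable [measurable]:
  assumes [measurable]: "f \<in> borel_measurable M" "g \<in> borel_measurable M"
  shows "(\<lambda>x. p (f x) (g x)) \<in> borel_measurable M"
  unfolding p_eq by measurable

lemma nn_integral_p [simp]: "(\<integral>\<^sup>+y. ennreal (p \<theta> y) \<partial>lborel) = 1"
proof -
  have "(\<integral>\<^sup>+y. ennreal (p \<theta> y) \<partial>lborel) = (\<integral>\<^sup>+y. ennreal (p \<theta> (\<theta> + y)) \<partial>lborel)"
    by (rule nn_integral_lborel_translate[symmetric]) simp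
  also have "\<dots> = (\<integral>\<^sup>+y. ennreal (exp (- ip y y / 2)) * ennreal (1 / Z) \<partial>lborel)"
    by (rule nn_integral_cong) (simp add: p_eq ennreal_mult[symmetric] gaussian_integral(1) less_imp_le)
  also have "\<dots> = ennreal Z * ennreal (1 / Z)"
    by (subst nn_integral_multc) (simp_all only: gaussian_integral(2), simp)
  also have "\<dots> = 1"
    using gaussian_integral(1) by (simp add: ennreal_mult[symmetric])
  finally show ?thesis .
qed

text \<open>The three exponents enter with weights 2, 1 and -2, which add up to 1. Hence the part
  quadratic in y is that of a single Gaussian with the same covariance, exactly one factor
  \<open>1 / Z\<close> survives, and the mean is 2u + v - 2c.\<close>

lemma p_product:
  "(p u y)\<^sup>2 * p v y / (p c y)\<^sup>2
    = exp (ip (u - c) (u - c) + 2 * ip (u - c) (v - c)) * p (c + 2 *\<^sub>R (u - c) + (v - c)) y"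
proof -
  define x a b where "x = y - c" and "a = u - c" and "b = v - c"
  have s: "y - u = x - a" "y - v = x - b" "y - c = x" "y - (c + 2 *\<^sub>R a + b) = x - 2 *\<^sub>R a - b"
    by (auto simp: x_def a_def b_def)
  have quot: "(exp r / Z)\<^sup>2 * (exp s / Z) / (exp t / Z)\<^sup>2 = exp (2 * r + s - 2 * t) / Z" for r s t
    using gaussian_integral(1) by (simp add: exp_add exp_diff exp_double power_divide)
  have "(p u y)\<^sup>2 * p v y / (p c y)\<^sup>2
      = exp (2 * (- ip (x - a) (x - a) / 2) + - ip (x - b) (x - b) / 2 - 2 * (- ip x x / 2)) / Z"
    unfolding p_eq s quot ..
  also have "2 * (- ip (x - a) (x - a) / 2) + - ip (x - b) (x - b) / 2 - 2 * (- ip x x / 2)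
      = (ip a a + 2 * ip a b) + - ip (x - 2 *\<^sub>R a - b) (x - 2 *\<^sub>R a - b) / 2"
    by (simp add: ip_commute[of a x] ip_commute[of b x] ip_commute[of b a] field_simps)
  finally show ?thesis
    unfolding a_def[symmetric] b_def[symmetric] p_eq[of "c + _ + _"] s
    by (simp only: exp_add times_divide_eq_right)
qed

lemma p_square:
  "(p u y)\<^sup>2 / p c y = exp (ip (u - c) (u - c)) * p (c + 2 *\<^sub>R (u - c)) y"
  using p_product[of u y c c] by (simp add: power2_eq_square)

end

section \<open>Mixtures, reflections and convex families\<close>

lemma space_mix_measure [simp]: "space (mix_measure t M N) = space M"
  and sets_mix_measure [simp, measurable_cong]: "sets (mix_measure t M N) = sets M"
  by (simp_all add: mix_measure_def space_measure_of_conv sets.sigma_sets_eq sets.space_closed)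

lemma emeasure_mix_measure:
  assumes N: "sets N = sets M" and A: "A \<in> sets M"
  shows "emeasure (mix_measure t M N) A = ennreal (1 - t) * emeasure M A + ennreal t * emeasure N A"
  unfolding mix_measure_def
proof (rule emeasure_measure_of_sigma[OF sets.sigma_algebra_axioms _ _ A])
  show "positive (sets M) (\<lambda>A. ennreal (1 - t) * emeasure M A + ennreal t * emeasure N A)"
    by (simp add: positive_def)
  show "countably_additive (sets M) (\<lambda>A. ennreal (1 - t) * emeasure M A + ennreal t * emeasure N A)"
    unfolding countably_additive_def
  proof safe
    fix A :: "nat \<Rightarrow> 'a set"
    assume A: "range A \<subseteq> sets M" "disjoint_family A"
    then show "(\<Sum>i. ennreal (1 - t) * emeasure M (A i) + ennreal t * emeasure N (A i))
        = ennreal (1 - t) * emeasure M (\<Union> (range A)) + ennreal t * emeasure N (\<Union> (range A))"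
      by (simp add: suminf_add[symmetric] suminf_emeasure N)
  qed
qed

text \<open>\<open>mix_measure\<close> is given by its values on sets, so linearity is built up from
  indicators through sums and monotone limits.\<close>

lemma nn_integral_mix_measure:
  assumes N: "sets N = sets M" and f: "f \<in> borel_measurable M"
  shows "(\<integral>\<^sup>+x. f x \<partial>mix_measure t M N) = ennreal (1 - t) * (\<integral>\<^sup>+x. f x \<partial>M) + ennreal t * (\<integral>\<^sup>+x. f x \<partial>N)"
  using f
proof (induction rule: borel_measurable_induct)
  case (cong f g)
  moreover have "space N = space M" using N by (rule sets_eq_imp_space_eq)
  ultimately show ?case by (metis (no_types, lifting) nn_integral_cong space_mix_measure)
next
  case (set A)
  then show ?case by (simp add: emeasure_mix_measure N)
next
  case (mult u c)
  then have [measurable]: "u \<in> borel_measurable N" by (simp add: measurable_cong_sets[OF N refl])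
  note [measurable] = mult(2)
  show ?case by (simp add: nn_integral_cmult mult distrib_left mult_ac)
next
  case (add u v)
  then have [measurable]: "u \<in> borel_measurable N" "v \<in> borel_measurable N"
    by (simp_all add: measurable_cong_sets[OF N refl])
  note [measurable] = add(1,3)
  show ?case by (simp add: nn_integral_add add distrib_left add_ac)
next
  case (seq U)
  then have N': "U i \<in> borel_measurable N" for i by (simp add: measurable_cong_sets[OF N refl])
  have mono: "incseq (\<lambda>i. \<integral>\<^sup>+x. U i x \<partial>L)" for L
    using seq(3) by (auto simp: incseq_def le_fun_def intro!: nn_integral_mono)
  have sup: "(\<integral>\<^sup>+x. Sup (range U) x \<partial>L) = (SUP i. \<integral>\<^sup>+x. U i x \<partial>L)"
    if "\<And>i. U i \<in> borel_measurable L" for L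
    using nn_integral_monotone_convergence_SUP[OF seq(3) that] by (simp add: image_comp)
  have "(\<integral>\<^sup>+x. Sup (range U) x \<partial>mix_measure t M N)
      = (SUP i. ennreal (1 - t) * (\<integral>\<^sup>+x. U i x \<partial>M) + ennreal t * (\<integral>\<^sup>+x. U i x \<partial>N))"
    using seq by (subst sup) simp_all
  also have "\<dots> = (SUP i. ennreal (1 - t) * (\<integral>\<^sup>+x. U i x \<partial>M)) + (SUP i. ennreal t * (\<integral>\<^sup>+x. U i x \<partial>N))"
    using mono by (intro ennreal_SUP_add) (auto simp: incseq_def intro!: mult_left_mono)
  also have "\<dots> = ennreal (1 - t) * (\<integral>\<^sup>+x. Sup (range U) x \<partial>M) + ennreal t * (\<integral>\<^sup>+x. Sup (range U) x \<partial>N)"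
    unfolding sup[OF seq(1)] sup[OF N'] by (simp add: SUP_mult_left_ennreal)
  finally show ?case .
qed

text \<open>Merges the density case and the mass-function case into the one property used later,
  invariance under the point reflection at c. With a density it comes from invariance of Lebesgue
  measure under negation and translation, with atoms from reindexing a countable sum.\<close>

lemma symmetrical_around_reflection:
  fixes c :: "real^'n"
  assumes \<mu>: "distribution_on \<Theta> \<mu>" and sym: "symmetrical_around \<Theta> \<mu> c"
  shows "distr \<mu> borel (\<lambda>x. 2 *\<^sub>R c - x) = \<mu>"
proof -
  define r where "r = (\<lambda>x. 2 *\<^sub>R c - x)"
  have [measurable]: "r \<in> borel_measurable borel" by (simp add: r_def)
  have rr: "r (r x) = x" for x by (simp add: r_def)
  have mid: "c = (1/2) *\<^sub>R (r x + x)" for x by (simp add: r_def)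
  have sets [simp, measurable_cong]: "sets \<mu> = sets borel" using \<mu> by (simp add: distribution_on_def)
  have space [simp]: "space \<mu> = UNIV" using sets_eq_imp_space_eq[OF sets] by simp
  have rborel: "r -` A \<in> sets borel" if "A \<in> sets borel" for A
    using measurable_sets[of r borel borel A] that by simp
  consider f where "f \<in> borel_measurable borel" "\<mu> = density lborel (\<lambda>x. ennreal (f x))"
      "\<And>x. f (r x) = f x"
    | S where "countable S" "AE x in \<mu>. x \<in> S" "\<And>x. measure \<mu> {r x} = measure \<mu> {x}"
    using sym[unfolded symmetrical_around_def]
  proof (elim disjE exE conjE)
    fix f :: "real^'n \<Rightarrow> real"
    assume f: "f \<in> borel_measurable borel" "\<mu> = density lborel (\<lambda>x. ennreal (f x))"
      and s: "\<forall>\<theta>1 \<theta>2. c = (1/2) *\<^sub>R (\<theta>1 + \<theta>2) \<longrightarrow> f \<theta>1 = f \<theta>2"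
    show thesis by (rule that(1)[OF f]) (rule s[rule_format, OF mid])
  next
    fix S
    assume S: "countable S" "AE x in \<mu>. x \<in> S"
      and s: "\<forall>\<theta>1 \<theta>2. c = (1/2) *\<^sub>R (\<theta>1 + \<theta>2) \<longrightarrow> measure \<mu> {\<theta>1} = measure \<mu> {\<theta>2}"
    show thesis by (rule that(2)[OF S]) (rule s[rule_format, OF mid])
  qed
  then have "distr \<mu> borel r = \<mu>"
  proof cases
    case 1
    note [measurable] = 1(1)
    show ?thesis
    proof (rule measure_eqI)
      fix A assume "A \<in> sets (distr \<mu> borel r)"
      then have [measurable]: "A \<in> sets borel" by simp
      have orth: "orthogonal_transformation (uminus :: real^'n \<Rightarrow> _)"
        by (simp add: orthogonal_transformation linear_iff)
      have "emeasure (distr \<mu> borel r) A = emeasure \<mu> (r -` A)"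
        by (simp add: emeasure_distr)
      also have "\<dots> = (\<integral>\<^sup>+x. ennreal (f x) * indicator (r -` A) x \<partial>lborel)"
        using rborel by (simp add: 1(2) emeasure_density)
      also have "\<dots> = (\<integral>\<^sup>+x. ennreal (f (r x)) * indicator A (r x) \<partial>lborel)"
        by (simp add: 1(3) indicator_def)
      also have "\<dots> = (\<integral>\<^sup>+x. (\<lambda>x. ennreal (f (2 *\<^sub>R c + x)) * indicator A (2 *\<^sub>R c + x)) (- x) \<partial>lborel)"
        by (simp add: r_def)
      also have "\<dots> = (\<integral>\<^sup>+x. ennreal (f (2 *\<^sub>R c + x)) * indicator A (2 *\<^sub>R c + x) \<partial>lborel)"
        by (rule nn_integral_lborel_orthogonal_transformation[OF orth]) simp
      also have "\<dots> = (\<integral>\<^sup>+x. ennreal (f x) * indicator A x \<partial>lborel)"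
        by (rule nn_integral_lborel_translate) simp
      also have "\<dots> = emeasure \<mu> A" by (simp add: 1(2) emeasure_density)
      finally show "emeasure (distr \<mu> borel r) A = emeasure \<mu> A" .
    qed simp
  next
    case 2
    interpret prob_space \<mu> using \<mu> by (simp add: distribution_on_def)
    \<comment> \<open>The support \<open>S\<close> need not be symmetric; adding its mirror image
      makes the reflection a bijection between the atoms in the preimage of \<open>A\<close> and
      those in \<open>A\<close>.\<close>
    define S' where "S' = S \<union> r ` S"
    have S': "countable S'" "AE x in \<mu>. x \<in> S'" using 2 by (auto simp: S'_def)
    have rS: "r x \<in> S' \<longleftrightarrow> x \<in> S'" for x unfolding S'_def using rr by (metis Un_iff imageE imageI)
    have [measurable]: "countable C \<Longrightarrow> C \<in> sets borel" for C :: "(real^'n) set"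
      by (rule sets.countable) auto
    have atoms: "emeasure \<mu> B = (\<integral>\<^sup>+x. emeasure \<mu> {x} \<partial>count_space (B \<inter> S'))" if "B \<in> sets borel" for B
    proof -
      have "emeasure \<mu> B = emeasure \<mu> (B \<inter> S')"
        using S' that by (intro emeasure_eq_AE) auto
      also have "\<dots> = (\<integral>\<^sup>+x. emeasure \<mu> {x} \<partial>count_space (B \<inter> S'))"
        using S' by (intro emeasure_countable_singleton) auto
      finally show ?thesis .
    qed
    show ?thesis
    proof (rule measure_eqI)
      fix A assume "A \<in> sets (distr \<mu> borel r)"
      then have A: "A \<in> sets borel" by simp
      have "emeasure (distr \<mu> borel r) A = emeasure \<mu> (r -` A)"
        using A by (simp add: emeasure_distr)
      also have "\<dots> = (\<integral>\<^sup>+x. emeasure \<mu> {x} \<partial>count_space (r -` A \<inter> S'))"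
        using rborel A by (intro atoms) auto
      also have "\<dots> = (\<integral>\<^sup>+x. emeasure \<mu> {r x} \<partial>count_space (r -` A \<inter> S'))"
        by (simp add: emeasure_eq_measure 2(3))
      also have "\<dots> = (\<integral>\<^sup>+x. emeasure \<mu> {x} \<partial>count_space (A \<inter> S'))"
      proof (rule nn_integral_bij_count_space[of r _ _ "\<lambda>x. emeasure \<mu> {x}"])
        show "bij_betw r (r -` A \<inter> S') (A \<inter> S')"
          by (rule bij_betwI[of _ _ _ r]) (auto simp: rr rS)
      qed
      also have "\<dots> = emeasure \<mu> A" using A by (rule atoms[symmetric])
      finally show "emeasure (distr \<mu> borel r) A = emeasure \<mu> A" .
    qed simp
  qed
  then show ?thesis by (simp add: r_def)
qed

text \<open>The one-sided half of Danskin's theorem: by convexity in \<open>t\<close>, a chord bound at one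
  point of \<open>(0, 1)\<close> propagates down to \<open>0\<close>; compactness makes that point uniform.\<close>

lemma convex_family_uniform_upper_bound:
  fixes F :: "real \<Rightarrow> 'a::topological_space \<Rightarrow> real"
  assumes K: "compact K"
    and cont: "\<And>s. 0 < s \<Longrightarrow> s < 1 \<Longrightarrow> continuous_on K (F s)"
    and conv: "\<And>u s t. u \<in> K \<Longrightarrow> 0 < s \<Longrightarrow> s < 1 \<Longrightarrow> 0 \<le> t \<Longrightarrow> t \<le> s \<Longrightarrow>
                 F t u \<le> (1 - t / s) * F 0 u + (t / s) * F s u"
    and F0: "\<And>u. u \<in> K \<Longrightarrow> F 0 u \<le> M"
    and slope: "\<And>u. u \<in> K \<Longrightarrow> \<exists>s. 0 < s \<and> s < 1 \<and> F s u < M + s * D"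
  shows "\<exists>r. 0 < r \<and> r < 1 \<and> (\<forall>t u. 0 \<le> t \<longrightarrow> t \<le> r \<longrightarrow> u \<in> K \<longrightarrow> F t u \<le> M + t * D)"
proof -
  obtain s where s: "\<And>u. u \<in> K \<Longrightarrow> 0 < s u \<and> s u < 1 \<and> F (s u) u < M + s u * D"
    using slope by metis
  have "\<exists>T. open T \<and> T \<inter> K = F (s u) -` {..<M + s u * D} \<inter> K" if "u \<in> K" for u
  proof -
    have "continuous_on K (F (s u))" using cont s that by blast
    from this[unfolded continuous_on_open_invariant, rule_format, OF open_lessThan] show ?thesis .
  qed
  then obtain T where T: "\<And>u. u \<in> K \<Longrightarrow> open (T u) \<and> T u \<inter> K = F (s u) -` {..<M + s u * D} \<inter> K"
    by metis
  have "K \<subseteq> (\<Union>u\<in>K. T u)"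
  proof
    fix u assume "u \<in> K"
    then have "u \<in> T u" using s[of u] T[of u] by blast
    with \<open>u \<in> K\<close> show "u \<in> (\<Union>u\<in>K. T u)" by blast
  qed
  then obtain C where C: "C \<subseteq> K" "finite C" "K \<subseteq> (\<Union>u\<in>C. T u)"
    using compactE_image[OF K, of K T] T by blast
  \<comment> \<open>The value 1/2 keeps r below 1 and the minimum meaningful when \<open>C\<close>
    is empty.\<close>
  define r where "r = Min (insert (1/2) (s ` C))"
  have r: "0 < r" "r < 1" "\<And>c. c \<in> C \<Longrightarrow> r \<le> s c"
    using C s by (auto simp: r_def Min_gr_iff Min_less_iff intro: Min_le)
  have "F t u \<le> M + t * D" if t: "0 \<le> t" "t \<le> r" and u: "u \<in> K" for t u
  proof -
    obtain c where c: "c \<in> C" "u \<in> T c" using C u by blast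
    have sc: "0 < s c" "s c < 1" "t \<le> s c" using s[of c] c C r(3)[of c] t by auto
    have "F (s c) u < M + s c * D" using T[of c] c C u by blast
    then have "F t u \<le> (1 - t / s c) * M + (t / s c) * (M + s c * D)"
      using conv[OF u sc(1,2) t(1) sc(3)] F0[OF u] sc t
      by (intro order_trans[OF conv[OF u sc(1,2) t(1) sc(3)]] add_mono mult_left_mono) auto
    also have "\<dots> = M + t * D" using sc by (simp add: field_simps)
    finally show ?thesis .
  qed
  with r show ?thesis by blast
qed

text \<open>Convexity of the reciprocal, from which convexity of \<open>F\<close> in t
  derives.\<close>

lemma inverse_mean_le:
  fixes a b l :: real
  assumes "0 < a" "0 < b" "0 \<le> l" "l \<le> 1"
  shows "1 / ((1 - l) * a + l * b) \<le> (1 - l) / a + l / b"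
proof -
  have pos: "0 < (1 - l) * a + l * b"
    using assms by (cases "l = 1") (auto intro!: add_pos_nonneg)
  have "((1 - l) / a + l / b) * ((1 - l) * a + l * b) - 1 = l * (1 - l) * (a - b)\<^sup>2 / (a * b)"
    using assms by (simp add: field_simps power2_eq_square)
  also have "\<dots> \<ge> 0" using assms by (intro divide_nonneg_pos mult_nonneg_nonneg) auto
  finally show ?thesis using pos by (simp add: pos_divide_le_eq)
qed

section \<open>Chi-square divergence between Gaussians of equal covariance\<close>

context covariance_matrix
begin

lemma integrable_p [simp]: "integrable lborel (p \<theta>)"
  and integral_p [simp]: "(LINT y|lborel. p \<theta> y) = 1"
proof -
  have "has_bochner_integral lborel (p \<theta>) 1"
    by (rule has_bochner_integral_nn_integral) auto
  then show "integrable lborel (p \<theta>)" "(LINT y|lborel. p \<theta> y) = 1"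
    by (auto simp: has_bochner_integral_iff)
qed

text \<open>The Radon-Nikodym derivative is almost everywhere \<open>p u y / p c y\<close>.
  Expanding the square and absorbing the density of the base measure leaves three integrals with
  values \<open>exp (ip (u - c) (u - c))\<close>, -2 and 1.\<close>

lemma chi2_div_mvn:
  "chi2_div (mvn \<Sigma> c) (mvn \<Sigma> u) = ennreal (exp (ip (u - c) (u - c)) - 1)"
proof -
  have mvn: "sets (mvn \<Sigma> v) = sets borel" "prob_space (mvn \<Sigma> v)" for v
    by (auto simp: mvn_def emeasure_density intro!: prob_spaceI)
  interpret P: prob_space "mvn \<Sigma> c" by (rule mvn)
  have meas: "(\<lambda>y. ennreal (p u y / p c y)) \<in> borel_measurable (mvn \<Sigma> c)"
    by (simp add: mvn_def)
  have dens: "density (mvn \<Sigma> c) (\<lambda>y. ennreal (p u y / p c y)) = mvn \<Sigma> u"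
    unfolding mvn_def by (subst density_density_eq) (auto simp: ennreal_mult[symmetric])
  have ac: "absolutely_continuous (mvn \<Sigma> c) (mvn \<Sigma> u)"
    using absolutely_continuousI_density[OF meas] dens by simp
  have "chi2_div (mvn \<Sigma> c) (mvn \<Sigma> u)
      = (\<integral>\<^sup>+y. ennreal ((enn2real (RN_deriv (mvn \<Sigma> c) (mvn \<Sigma> u) y) - 1)\<^sup>2) \<partial>mvn \<Sigma> c)"
    using ac by (simp add: chi2_div_def)
  also have "\<dots> = (\<integral>\<^sup>+y. ennreal ((p u y / p c y - 1)\<^sup>2) \<partial>mvn \<Sigma> c)"
    using P.RN_deriv_unique[OF meas dens]
    by (intro nn_integral_cong_AE) (auto elim!: eventually_mono dest: sym)
  also have "\<dots> = (\<integral>\<^sup>+y. ennreal ((p u y)\<^sup>2 / p c y - 2 * p u y + p c y) \<partial>lborel)"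
    unfolding mvn_def
  proof (subst nn_integral_density, simp, simp, rule nn_integral_cong)
    fix y
    have "p c y * (p u y / p c y - 1)\<^sup>2 = (p u y)\<^sup>2 / p c y - 2 * p u y + p c y"
      by (simp add: power2_eq_square field_simps)
    then show "ennreal (p c y) * ennreal ((p u y / p c y - 1)\<^sup>2)
        = ennreal ((p u y)\<^sup>2 / p c y - 2 * p u y + p c y)"
      by (simp add: ennreal_mult[symmetric])
  qed
  also have "\<dots> = ennreal (LINT y|lborel. (p u y)\<^sup>2 / p c y - 2 * p u y + p c y)"
  proof (rule nn_integral_eq_integral)
    show "integrable lborel (\<lambda>y. (p u y)\<^sup>2 / p c y - 2 * p u y + p c y)"
      unfolding p_square by simp
    have "(p u y)\<^sup>2 / p c y - 2 * p u y + p c y = (p u y - p c y)\<^sup>2 / p c y" for y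
      by (simp add: power2_eq_square field_simps)
    then show "AE y in lborel. 0 \<le> (p u y)\<^sup>2 / p c y - 2 * p u y + p c y" by simp
  qed
  also have "(LINT y|lborel. (p u y)\<^sup>2 / p c y - 2 * p u y + p c y) = exp (ip (u - c) (u - c)) - 1"
    unfolding p_square by simp
  finally show ?thesis .
qed

end

section \<open>The mixture direction\<close>

locale symmetric_mixing = covariance_matrix \<Sigma> for \<Sigma> :: "real^'n^'n" +
  fixes \<Theta> :: "(real^'n) set" and h :: "real^'n" and \<mu> :: "(real^'n) measure"
  assumes open_\<Theta>: "open \<Theta>" and h: "h \<in> \<Theta>"
    and \<mu>: "distribution_on \<Theta> \<mu>" and symmetric: "symmetrical_around \<Theta> \<mu> h"
begin

sublocale mu: prob_space \<mu>
  using \<mu> by (simp add: distribution_on_def)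

lemma sets_\<mu> [simp, measurable_cong]: "sets \<mu> = sets borel"
  using \<mu> by (simp add: distribution_on_def)

lemma space_\<mu> [simp]: "space \<mu> = UNIV"
  using sets_eq_imp_space_eq[OF sets_\<mu>] by simp

lemma \<Theta>_borel [measurable]: "\<Theta> \<in> sets borel"
  using open_\<Theta> by simp

lemma AE_\<Theta>: "AE \<theta>' in \<mu>. \<theta>' \<in> \<Theta>"
  using \<mu> by (simp add: distribution_on_def)

sublocale lborel_mu: pair_sigma_finite \<mu> lborel ..

text \<open>The mixture density, integrated over the whole space; it equals the integral over
  \<open>\<Theta>\<close> since \<open>\<mu>\<close> gives \<open>\<Theta>\<close> full
  mass.\<close>

definition m :: "real^'n \<Rightarrow> real" where "m y = (LINT \<theta>'|\<mu>. p \<theta>' y)"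

lemma p_le: "p \<theta> y \<le> 1 / Z"
proof -
  have "exp (- ip (y - \<theta>) (y - \<theta>) / 2) \<le> 1"
    using ip_nonneg[of "y - \<theta>"] by (simp del: ip_linear)
  then show ?thesis
    unfolding p_eq using gaussian_integral(1) by (intro divide_right_mono) auto
qed

lemma integrable_p_\<mu>: "integrable \<mu> (\<lambda>\<theta>'. p \<theta>' y)"
  by (rule mu.integrable_const_bound[where B = "1 / Z"]) (auto simp: p_le)

lemma m_nonneg [simp]: "0 \<le> m y"
  by (simp add: m_def)

lemma nn_integral_m: "(\<integral>\<^sup>+\<theta>'. ennreal (p \<theta>' y) \<partial>\<mu>) = ennreal (m y)"
  unfolding m_def by (rule nn_integral_eq_integral[OF integrable_p_\<mu>]) simp

lemma nn_set_integral_m: "(\<integral>\<^sup>+\<theta>'\<in>\<Theta>. ennreal (p \<theta>' y) \<partial>\<mu>) = ennreal (m y)"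
  unfolding nn_integral_m[symmetric]
  by (rule nn_integral_cong_AE) (use AE_\<Theta> in \<open>auto elim!: eventually_mono\<close>)

lemma set_integral_m: "(LINT \<theta>':\<Theta>|\<mu>. p \<theta>' y) = m y"
  unfolding m_def set_lebesgue_integral_def
  by (rule integral_cong_AE) (use AE_\<Theta> in \<open>auto elim!: eventually_mono\<close>)

lemma set_integral_return: "(LINT \<theta>':\<Theta>|return borel h. p \<theta>' y) = p h y"
  using h by (simp add: set_lebesgue_integral_def integral_return)

lemma m_measurable [measurable]: "m \<in> borel_measurable borel"
proof -
  have "(\<lambda>y. LINT \<theta>'|\<mu>. p \<theta>' y) \<in> borel_measurable borel"
    by (rule mu.borel_measurable_lebesgue_integral) measurable
  then show ?thesis by (simp add: m_def[abs_def])
qed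

section \<open>The functional along the segment from the point mass to the mixing measure\<close>

definition den :: "real \<Rightarrow> real^'n \<Rightarrow> real" where
  "den t y = (1 - t) * p h y + t * m y"

definition F :: "real \<Rightarrow> real^'n \<Rightarrow> real" where
  "F t u = (LINT y|lborel. (p u y)\<^sup>2 / den t y)"

abbreviation q :: "real^'n \<Rightarrow> real" where "q u \<equiv> ip (u - h) (u - h)"

lemma den_0 [simp]: "den 0 y = p h y"
  by (simp add: den_def)

lemma den_measurable [measurable]: "den t \<in> borel_measurable borel"
  unfolding den_def[abs_def] by measurable

text \<open>The share of the point mass alone bounds the denominator. For t < 1 every integrand is
  thereby dominated by a multiple of the explicit one at t = 0, whatever \<open>\<mu>\<close>
  is.\<close>

lemma den_ge: "0 \<le> t \<Longrightarrow> (1 - t) * p h y \<le> den t y"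
  by (simp add: den_def)

lemma den_pos: "0 \<le> t \<Longrightarrow> t < 1 \<Longrightarrow> 0 < den t y"
  by (rule less_le_trans[OF _ den_ge]) auto

lemma quotient_le:
  assumes "0 \<le> t" "t < 1"
  shows "(p u y)\<^sup>2 / den t y \<le> (p u y)\<^sup>2 / p h y / (1 - t)"
proof -
  have "(p u y)\<^sup>2 / den t y \<le> (p u y)\<^sup>2 / ((1 - t) * p h y)"
    using assms den_ge[OF assms(1)] by (intro divide_left_mono mult_pos_pos den_pos) auto
  then show ?thesis by (simp add: mult.commute)
qed

lemma integrable_square: "integrable lborel (\<lambda>y. (p u y)\<^sup>2 / p h y)"
  and integral_square: "(LINT y|lborel. (p u y)\<^sup>2 / p h y) = exp (q u)"
  unfolding p_square by simp_all

lemma integrable_F: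
  assumes "0 \<le> t" "t < 1"
  shows "integrable lborel (\<lambda>y. (p u y)\<^sup>2 / den t y)"
proof (rule Bochner_Integration.integrable_bound)
  show "integrable lborel (\<lambda>y. (p u y)\<^sup>2 / p h y / (1 - t))"
    by (rule integrable_divide[OF integrable_square])
  show "AE y in lborel. norm ((p u y)\<^sup>2 / den t y) \<le> norm ((p u y)\<^sup>2 / p h y / (1 - t))"
    using quotient_le[OF assms] den_pos[OF assms] assms by (auto simp: less_imp_le)
qed simp

lemma F_0: "F 0 u = exp (q u)"
  unfolding F_def by (simp only: den_0 integral_square)

lemma F_nonneg: "0 \<le> t \<Longrightarrow> t < 1 \<Longrightarrow> 0 \<le> F t u"
  unfolding F_def by (intro Bochner_Integration.integral_nonneg) (simp add: den_pos less_imp_le)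

lemma F_le:
  assumes "0 \<le> t" "t < 1"
  shows "F t u \<le> exp (q u) / (1 - t)"
proof -
  have "F t u \<le> (LINT y|lborel. (p u y)\<^sup>2 / p h y / (1 - t))"
    unfolding F_def
    by (intro integral_mono integrable_F assms integrable_divide integrable_square quotient_le)
  also have "\<dots> = exp (q u) / (1 - t)"
    by (simp only: integral_divide_zero integral_square)
  finally show ?thesis .
qed

lemma L_fun_mix:
  assumes "0 \<le> t" "t < 1"
  shows "L_fun \<Theta> \<Sigma> (mix_measure t (return borel h) \<mu>) u = ennreal (F t u)"
proof -
  have "(\<integral>\<^sup>+\<theta>'\<in>\<Theta>. ennreal (p \<theta>' y) \<partial>mix_measure t (return borel h) \<mu>) = ennreal (den t y)" for y
  proof -
    have "(\<integral>\<^sup>+\<theta>'\<in>\<Theta>. ennreal (p \<theta>' y) \<partial>mix_measure t (return borel h) \<mu>)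
        = ennreal (1 - t) * (\<integral>\<^sup>+\<theta>'\<in>\<Theta>. ennreal (p \<theta>' y) \<partial>return borel h)
          + ennreal t * (\<integral>\<^sup>+\<theta>'\<in>\<Theta>. ennreal (p \<theta>' y) \<partial>\<mu>)"
      by (rule nn_integral_mix_measure) simp_all
    also have "\<dots> = ennreal (1 - t) * ennreal (p h y) + ennreal t * ennreal (m y)"
      using h by (simp add: nn_set_integral_m nn_integral_return)
    also have "\<dots> = ennreal (den t y)"
      using assms by (simp add: den_def ennreal_mult[symmetric] ennreal_plus[symmetric] del: ennreal_plus)
    finally show ?thesis .
  qed
  then have "L_fun \<Theta> \<Sigma> (mix_measure t (return borel h) \<mu>) u
      = (\<integral>\<^sup>+y. ennreal ((p u y)\<^sup>2 / den t y) \<partial>lborel)"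
    by (simp add: L_fun_def divide_ennreal den_pos[OF assms])
  also have "\<dots> = ennreal (F t u)"
    unfolding F_def
    by (rule nn_integral_eq_integral[OF integrable_F[OF assms]]) (simp add: den_pos[OF assms] less_imp_le)
  finally show ?thesis .
qed

lemma mix_measure_0: "mix_measure 0 (return borel h) \<mu> = return borel h"
  by (rule measure_eqI) (simp_all add: emeasure_mix_measure)

lemma L_fun_return: "L_fun \<Theta> \<Sigma> (return borel h) u = ennreal (exp (q u))"
  using L_fun_mix[of 0 u] by (simp add: mix_measure_0 F_0 del: ip_linear)

text \<open>\<open>den\<close> is affine in t and the reciprocal is convex, so the integrand is
  convex in t for each y.\<close>

lemma F_chord:
  assumes "0 < s" "s < 1" "0 \<le> t" "t \<le> s"
  shows "F t u \<le> (1 - t / s) * F 0 u + (t / s) * F s u"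
proof -
  have t: "t < 1" using assms by simp
  have den: "den t y = (1 - t / s) * p h y + (t / s) * den s y" for y
    using assms by (simp add: den_def field_simps)
  have "(p u y)\<^sup>2 / den t y \<le> (1 - t / s) * ((p u y)\<^sup>2 / p h y) + (t / s) * ((p u y)\<^sup>2 / den s y)" for y
  proof -
    have "1 / den t y \<le> (1 - t / s) / p h y + (t / s) / den s y"
      unfolding den using assms by (intro inverse_mean_le den_pos) auto
    from mult_left_mono[OF this, of "(p u y)\<^sup>2"] show ?thesis by (simp add: algebra_simps)
  qed
  then have "F t u \<le> (LINT y|lborel. (1 - t / s) * ((p u y)\<^sup>2 / p h y) + (t / s) * ((p u y)\<^sup>2 / den s y))"
    unfolding F_def using assms t
    by (intro integral_mono integrable_F Bochner_Integration.integrable_add integrable_mult_right integrable_square) auto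
  also have "\<dots> = (1 - t / s) * F 0 u + (t / s) * F s u"
    unfolding F_def den_0
    by (subst Bochner_Integration.integral_add[OF integrable_mult_right[OF integrable_square]
          integrable_mult_right[OF integrable_F]])
      (use assms in \<open>simp_all only: integral_mult_right_zero less_imp_le\<close>)
  finally show ?thesis .
qed

text \<open>\<open>exp (q u) * (p u y)\<^sup>2\<close> is the exponential of an affine function of \<open>u\<close>, so
  \<open>exp (q u) * F s u\<close> is a finite convex function on the whole space.\<close>

lemma continuous_F:
  assumes s: "0 \<le> s" "s < 1"
  shows "continuous_on A (F s)"
proof -
  define w where "w y u = 2 * ip y u - 2 * ip u h + ip h h - ip y y" for y u
  have ep: "exp (q u) * (p u y)\<^sup>2 = exp (w y u) / Z\<^sup>2" for u y
  proof -
    have "q u + 2 * (- ip (y - u) (y - u) / 2) = w y u"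
      by (simp add: w_def ip_commute[of h u] ip_commute[of u y] add_divide_distrib diff_divide_distrib)
    then have "exp (q u) * (exp (- ip (y - u) (y - u) / 2))\<^sup>2 = exp (w y u)"
      by (simp only: exp_double[symmetric] exp_add[symmetric])
    then show ?thesis
      by (simp only: p_eq power_divide times_divide_eq_right)
  qed
  define N where "N u = exp (q u) * F s u" for u
  have N: "N u = (LINT y|lborel. exp (w y u) / Z\<^sup>2 / den s y)" for u
    unfolding N_def F_def ep[symmetric] by (simp add: integral_mult_right_zero[symmetric] del: ip_linear integral_mult_right_zero)
  have int: "integrable lborel (\<lambda>y. exp (w y u) / Z\<^sup>2 / den s y)" for u
    using integrable_mult_right[OF integrable_F[OF s, of u], of "exp (q u)"]
    unfolding ep[symmetric] by (simp del: ip_linear)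
  have "convex_on UNIV N"
  proof (rule convex_onI)
    fix t :: real and x y :: "real^'n"
    assume t: "0 < t" "t < 1"
    have "exp (w z ((1 - t) *\<^sub>R x + t *\<^sub>R y)) \<le> (1 - t) * exp (w z x) + t * exp (w z y)" for z
    proof -
      have "w z ((1 - t) *\<^sub>R x + t *\<^sub>R y) = (1 - t) *\<^sub>R w z x + t *\<^sub>R w z y"
        by (simp add: w_def algebra_simps)
      then show ?thesis using convex_onD[OF exp_convex, of t "w z x" "w z y"] t by simp
    qed
    then have "exp (w z ((1 - t) *\<^sub>R x + t *\<^sub>R y)) / Z\<^sup>2 / den s z
        \<le> ((1 - t) * exp (w z x) + t * exp (w z y)) / Z\<^sup>2 / den s z" for z
      using den_pos[OF s] by (intro divide_right_mono) (auto simp: less_imp_le)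
    then have "N ((1 - t) *\<^sub>R x + t *\<^sub>R y)
        \<le> (LINT z|lborel. (1 - t) * (exp (w z x) / Z\<^sup>2 / den s z) + t * (exp (w z y) / Z\<^sup>2 / den s z))"
      unfolding N
      by (intro integral_mono int Bochner_Integration.integrable_add integrable_mult_right)
        (simp_all add: add_divide_distrib)
    also have "\<dots> = (1 - t) * N x + t * N y"
      unfolding N
      by (subst Bochner_Integration.integral_add[OF integrable_mult_right[OF int] integrable_mult_right[OF int]])
        (simp only: integral_mult_right_zero)
    finally show "N ((1 - t) *\<^sub>R x + t *\<^sub>R y) \<le> (1 - t) * N x + t * N y" .
  qed simp
  \<comment> \<open>A finite convex function on a whole finite-dimensional space is continuous,
    which replaces a search for a dominating function as u varies.\<close>
  then have "continuous_on UNIV N" by (intro convex_on_continuous) auto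
  then have "continuous_on A N" by (rule continuous_on_subset) simp
  then have "continuous_on A (\<lambda>u. exp (- q u) * N u)"
    by (intro continuous_on_mult continuous_on_exp continuous_on_minus ip_continuous
        continuous_on_diff continuous_on_id continuous_on_const)
  moreover have "exp (- q u) * N u = F s u" for u
    unfolding N_def mult.assoc[symmetric] exp_add[symmetric] by simp
  ultimately show ?thesis by simp
qed

section \<open>Directional derivatives and the exponential moment\<close>

definition E :: "real^'n \<Rightarrow> real" where
  "E u = (LINT \<theta>'|\<mu>. exp (2 * ip (u - h) (\<theta>' - h)))"

text \<open>The derivative of \<open>F t u\<close> in t at 0, formally taken under the
  integral.\<close>

definition G :: "real^'n \<Rightarrow> real" where
  "G u = (LINT y|lborel. (p u y)\<^sup>2 * (p h y - m y) / (p h y)\<^sup>2)"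

text \<open>Carried along explicitly because a non-integrable function has Lebesgue integral 0 by
  convention, which would make the value of \<open>E\<close> meaningless.\<close>

definition exp_integrable :: "real^'n \<Rightarrow> bool" where
  "exp_integrable u \<longleftrightarrow> integrable \<mu> (\<lambda>\<theta>'. exp (2 * ip (u - h) (\<theta>' - h)))"

text \<open>After exchanging the integrals, the inner one over y is that of a Gaussian density and
  equals 1. Working with nonnegative integrals makes the exchange unconditional and yields
  integrability as a result.\<close>

lemma has_integral_mixture:
  assumes u: "exp_integrable u"
  shows "has_bochner_integral lborel (\<lambda>y. (p u y)\<^sup>2 * m y / (p h y)\<^sup>2) (exp (q u) * E u)"
proof (rule has_bochner_integral_nn_integral)
  have "(\<integral>\<^sup>+y. ennreal ((p u y)\<^sup>2 * m y / (p h y)\<^sup>2) \<partial>lborel)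
      = (\<integral>\<^sup>+y. (\<integral>\<^sup>+\<theta>'. ennreal ((p u y)\<^sup>2 * p \<theta>' y / (p h y)\<^sup>2) \<partial>\<mu>) \<partial>lborel)"
  proof (rule nn_integral_cong)
    fix y
    have "(\<integral>\<^sup>+\<theta>'. ennreal ((p u y)\<^sup>2 * p \<theta>' y / (p h y)\<^sup>2) \<partial>\<mu>)
        = (\<integral>\<^sup>+\<theta>'. ennreal ((p u y)\<^sup>2 / (p h y)\<^sup>2) * ennreal (p \<theta>' y) \<partial>\<mu>)"
      by (simp add: ennreal_mult[symmetric])
    also have "\<dots> = ennreal ((p u y)\<^sup>2 / (p h y)\<^sup>2) * ennreal (m y)"
      by (simp add: nn_integral_cmult nn_integral_m)
    finally show "ennreal ((p u y)\<^sup>2 * m y / (p h y)\<^sup>2)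
        = (\<integral>\<^sup>+\<theta>'. ennreal ((p u y)\<^sup>2 * p \<theta>' y / (p h y)\<^sup>2) \<partial>\<mu>)"
      by (simp add: ennreal_mult[symmetric])
  qed
  also have "\<dots> = (\<integral>\<^sup>+\<theta>'. (\<integral>\<^sup>+y. ennreal ((p u y)\<^sup>2 * p \<theta>' y / (p h y)\<^sup>2) \<partial>lborel) \<partial>\<mu>)"
    by (rule lborel_mu.Fubini') measurable
  also have "\<dots> = (\<integral>\<^sup>+\<theta>'. ennreal (exp (q u)) * ennreal (exp (2 * ip (u - h) (\<theta>' - h))) \<partial>\<mu>)"
    unfolding p_product
    by (simp add: ennreal_mult nn_integral_cmult exp_add del: ip_linear)
  also have "\<dots> = ennreal (exp (q u)) * (\<integral>\<^sup>+\<theta>'. ennreal (exp (2 * ip (u - h) (\<theta>' - h))) \<partial>\<mu>)"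
    by (rule nn_integral_cmult) simp
  also have "(\<integral>\<^sup>+\<theta>'. ennreal (exp (2 * ip (u - h) (\<theta>' - h))) \<partial>\<mu>) = ennreal (E u)"
    unfolding E_def using u[unfolded exp_integrable_def] by (rule nn_integral_eq_integral) simp
  also have "ennreal (exp (q u)) * ennreal (E u) = ennreal (exp (q u) * E u)"
    by (simp add: ennreal_mult E_def del: ip_linear)
  finally show "(\<integral>\<^sup>+y. ennreal ((p u y)\<^sup>2 * m y / (p h y)\<^sup>2) \<partial>lborel) = ennreal (exp (q u) * E u)" .
qed (auto simp: E_def simp del: ip_linear)

lemma G_split: "(p u y)\<^sup>2 * (p h y - m y) / (p h y)\<^sup>2
    = (p u y)\<^sup>2 / p h y - (p u y)\<^sup>2 * m y / (p h y)\<^sup>2"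
  by (simp add: power2_eq_square field_simps)

lemma
  assumes u: "exp_integrable u"
  shows integrable_G: "integrable lborel (\<lambda>y. (p u y)\<^sup>2 * (p h y - m y) / (p h y)\<^sup>2)"
    and G_eq: "G u = exp (q u) * (1 - E u)"
  using has_integral_mixture[OF u] integrable_square integral_square
  unfolding G_def G_split has_bochner_integral_iff by (auto simp: right_diff_distrib simp del: ip_linear)

text \<open>The reciprocal lies above its tangent at \<open>p h y\<close>; integrating gives a bound
  for all t in [0, 1) at once, with no limit involved.\<close>

lemma F_tangent:
  assumes u: "exp_integrable u" and t: "0 \<le> t" "t < 1"
  shows "exp (q u) + t * G u \<le> F t u"
proof -
  have le: "(p u y)\<^sup>2 / p h y + t * ((p u y)\<^sup>2 * (p h y - m y) / (p h y)\<^sup>2) \<le> (p u y)\<^sup>2 / den t y" for y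
  proof -
    define a x where "a = p h y" and "x = t * (p h y - m y)"
    have d: "den t y = a - x" by (simp add: den_def a_def x_def algebra_simps)
    have a: "0 < a" "0 < a - x" using den_pos[OF t, of y] by (auto simp: d) (simp add: a_def)
    have "(1 / a + x / a\<^sup>2) * (a - x) \<le> 1"
    proof -
      have "(1 / a + x / a\<^sup>2) * (a - x) = 1 - (x / a)\<^sup>2"
        using a by (simp add: field_simps power2_eq_square)
      then show ?thesis by simp
    qed
    then have "1 / a + x / a\<^sup>2 \<le> 1 / (a - x)" using a by (simp add: pos_le_divide_eq)
    from mult_left_mono[OF this, of "(p u y)\<^sup>2"] show ?thesis
      unfolding d unfolding a_def x_def by (simp add: algebra_simps)
  qed
  have "exp (q u) + t * G u
      = (LINT y|lborel. (p u y)\<^sup>2 / p h y + t * ((p u y)\<^sup>2 * (p h y - m y) / (p h y)\<^sup>2))"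
    by (subst Bochner_Integration.integral_add[OF integrable_square
          integrable_mult_right[OF integrable_G[OF u]]])
      (simp only: integral_square integral_mult_right_zero G_def)
  also have "\<dots> \<le> F t u"
    unfolding F_def
    by (intro integral_mono integrable_F t Bochner_Integration.integrable_add integrable_mult_right
        integrable_G u integrable_square le)
  finally show ?thesis .
qed

text \<open>Dominated convergence identifies the limit of the difference quotients along a null
  sequence as \<open>G u\<close>; a single small step with quotient below \<open>D\<close> is all
  that is needed.\<close>

lemma F_slope:
  assumes u: "exp_integrable u" and D: "G u < D"
  shows "\<exists>s. 0 < s \<and> s < 1 \<and> F s u < exp (q u) + s * D"
proof -
  \<comment> \<open>The shift by 2 keeps the step at most 1/2, so \<open>den (s k) y\<close> is at
    least half of \<open>p h y\<close> and one dominating function serves all k.\<close>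
  define s where "s k = 1 / real (k + 2)" for k
  have s: "0 < s k" "s k \<le> 1/2" for k by (auto simp: s_def field_simps)
  have s0: "s \<longlonglongrightarrow> 0"
    unfolding s_def using LIMSEQ_ignore_initial_segment[OF lim_1_over_n, of 2] by simp
  \<comment> \<open>The integrand of the difference quotient with the factor \<open>s k\<close>
    already cancelled.\<close>
  let ?g = "\<lambda>k y. (p u y)\<^sup>2 * (p h y - m y) / (p h y * den (s k) y)"
  have "(\<lambda>k. LINT y|lborel. ?g k y) \<longlonglongrightarrow> (LINT y|lborel. (p u y)\<^sup>2 * (p h y - m y) / (p h y)\<^sup>2)"
  proof (rule integral_dominated_convergence)
    show "integrable lborel (\<lambda>y. 2 * ((p u y)\<^sup>2 / p h y + (p u y)\<^sup>2 * m y / (p h y)\<^sup>2))"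
      using has_integral_mixture[OF u]
      by (intro integrable_mult_right Bochner_Integration.integrable_add integrable_square)
        (simp add: has_bochner_integral_iff)
    show "AE y in lborel. (\<lambda>k. ?g k y) \<longlonglongrightarrow> (p u y)\<^sup>2 * (p h y - m y) / (p h y)\<^sup>2"
    proof (rule AE_I2)
      fix y
      have "(\<lambda>k. den (s k) y) \<longlonglongrightarrow> (1 - 0) * p h y + 0 * m y"
        unfolding den_def by (intro tendsto_intros s0)
      then have "(\<lambda>k. ?g k y) \<longlonglongrightarrow> (p u y)\<^sup>2 * (p h y - m y) / (p h y * p h y)"
        by (intro tendsto_intros) auto
      then show "(\<lambda>k. ?g k y) \<longlonglongrightarrow> (p u y)\<^sup>2 * (p h y - m y) / (p h y)\<^sup>2"
        by (simp add: power2_eq_square)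
    qed
    show "AE y in lborel. norm (?g k y) \<le> 2 * ((p u y)\<^sup>2 / p h y + (p u y)\<^sup>2 * m y / (p h y)\<^sup>2)" for k
    proof (rule AE_I2)
      fix y
      have dp: "0 < den (s k) y" using s[of k] by (intro den_pos) auto
      have "(1/2) * p h y \<le> (1 - s k) * p h y"
        using s[of k] by (intro mult_right_mono) auto
      also have "\<dots> \<le> den (s k) y" using s[of k] by (intro den_ge) auto
      finally have d: "(1/2) * p h y \<le> den (s k) y" .
      have "\<bar>p h y - m y\<bar> \<le> p h y + m y"
        using p_pos[of h y] m_nonneg[of y] unfolding abs_le_iff by linarith
      note d = d this
      have "norm (?g k y) = (p u y)\<^sup>2 * \<bar>p h y - m y\<bar> / (p h y * den (s k) y)"
        using dp by (simp add: abs_mult)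
      also have "\<dots> \<le> (p u y)\<^sup>2 * (p h y + m y) / (p h y * ((1/2) * p h y))"
        using d dp
        by (intro frac_le mult_left_mono mult_nonneg_nonneg mult_pos_pos) auto
      also have "\<dots> = 2 * ((p u y)\<^sup>2 / p h y + (p u y)\<^sup>2 * m y / (p h y)\<^sup>2)"
        by (simp add: power2_eq_square field_simps)
      finally show "norm (?g k y) \<le> 2 * ((p u y)\<^sup>2 / p h y + (p u y)\<^sup>2 * m y / (p h y)\<^sup>2)" .
    qed
  qed measurable
  moreover have "(LINT y|lborel. ?g k y) = (F (s k) u - exp (q u)) / s k" for k
  proof -
    have sk: "0 \<le> s k" "s k < 1" "s k \<noteq> 0" using s[of k] by auto
    have "?g k y = ((p u y)\<^sup>2 / den (s k) y - (p u y)\<^sup>2 / p h y) / s k" for y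
    proof -
      have d: "p h y - m y = (p h y - den (s k) y) / s k"
        using sk by (simp add: den_def field_simps)
      show ?thesis
        unfolding d using sk den_pos[OF sk(1,2), of y] by (simp add: field_simps)
    qed
    then have "(LINT y|lborel. ?g k y) = (LINT y|lborel. ((p u y)\<^sup>2 / den (s k) y - (p u y)\<^sup>2 / p h y) / s k)"
      by simp
    also have "\<dots> = (F (s k) u - exp (q u)) / s k"
      using integrable_F[OF sk(1,2), of u] integrable_square[of u] integral_square[of u]
      by (simp add: F_def del: ip_linear)
    finally show ?thesis .
  qed
  ultimately have "(\<lambda>k. (F (s k) u - exp (q u)) / s k) \<longlonglongrightarrow> G u"
    by (simp add: G_def del: ip_linear)
  from order_tendstoD(2)[OF this D] obtain k where "(F (s k) u - exp (q u)) / s k < D"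
    by (auto simp: eventually_sequentially simp del: ip_linear)
  then have "F (s k) u < exp (q u) + s k * D"
    using s[of k] by (simp add: pos_divide_less_eq algebra_simps del: ip_linear)
  then show ?thesis using s[of k] by (intro exI[of _ "s k"]) auto
qed

text \<open>By symmetry \<open>E u\<close> is the mean of \<open>cosh (2 Y)\<close>, and \<open>cosh\<close> exceeds \<open>1\<close> off \<open>0\<close>.\<close>

lemma E_gt_1:
  assumes u: "exp_integrable u" and nz: "\<not> (AE \<theta>' in \<mu>. ip (u - h) (\<theta>' - h) = 0)"
  shows "1 < E u"
proof -
  define Y where "Y \<theta>' = ip (u - h) (\<theta>' - h)" for \<theta>'
  have [measurable]: "Y \<in> borel_measurable borel" unfolding Y_def[abs_def] by measurable
  have Yr: "Y (2 *\<^sub>R h - x) = - Y x" for x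
  proof -
    have "2 *\<^sub>R h - x - h = - (x - h)" by (simp add: scaleR_2)
    then show ?thesis unfolding Y_def by (simp only: ip_linear(8))
  qed
  have i1: "integrable \<mu> (\<lambda>x. exp (2 * Y x))"
    using u unfolding exp_integrable_def Y_def .
  have refl: "distr \<mu> borel (\<lambda>x. 2 *\<^sub>R h - x) = \<mu>"
    using \<mu> symmetric by (rule symmetrical_around_reflection)
  \<comment> \<open>Integrability for the opposite sign is inherited through the reflection.\<close>
  have i2: "integrable \<mu> (\<lambda>x. exp (- 2 * Y x))"
    using i1 integrable_distr_eq[of "\<lambda>x. 2 *\<^sub>R h - x" \<mu> borel "\<lambda>x. exp (2 * Y x)"]
    by (simp add: refl Yr)
  have E1: "E u = (LINT x|\<mu>. exp (2 * Y x))" by (simp add: E_def Y_def del: ip_linear)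
  have E2: "E u = (LINT x|\<mu>. exp (- 2 * Y x))"
    using integral_distr[of "\<lambda>x. 2 *\<^sub>R h - x" \<mu> borel "\<lambda>x. exp (2 * Y x)"]
    by (simp add: E1 refl Yr)
  \<comment> \<open>This is four times the square of sinh Y; its mean is
    \<open>2 * E u - 2\<close>.\<close>
  define w where "w x = (exp (Y x) - exp (- Y x))\<^sup>2" for x
  have w: "w x = exp (2 * Y x) + exp (- 2 * Y x) - 2" for x
    by (simp add: w_def power2_diff exp_double[symmetric] exp_add[symmetric])
  have nonneg: "AE x in \<mu>. 0 \<le> w x" by (simp add: w_def)
  have iw: "integrable \<mu> w"
    unfolding w[abs_def] using i1 i2 by simp
  have "(LINT x|\<mu>. w x) = 2 * E u - 2"
    unfolding w using i1 i2 E1 E2 mu.prob_space by simp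
  moreover have "(LINT x|\<mu>. w x) \<noteq> 0"
  proof
    assume "(LINT x|\<mu>. w x) = 0"
    then have "AE x in \<mu>. w x = 0"
      using integral_nonneg_eq_0_iff_AE[OF iw nonneg] by blast
    then have "AE x in \<mu>. Y x = 0"
      by (rule eventually_mono) (simp add: w_def)
    then show False using nz by (simp add: Y_def del: ip_linear)
  qed
  moreover have "(LINT x|\<mu>. w x) \<ge> 0" by (simp add: w_def)
  ultimately show ?thesis by simp
qed

text \<open>The null set where domination fails may depend on u; along a sequence only countably
  many such sets occur, so dominated convergence still applies.\<close>

lemma continuous_E:
  assumes Y: "integrable \<mu> Y"
    and le: "\<And>u. u \<in> A \<Longrightarrow> AE \<theta>' in \<mu>. exp (2 * ip (u - h) (\<theta>' - h)) \<le> Y \<theta>'"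
  shows "continuous_on A E"
  unfolding continuous_on_sequentially
proof (intro allI ballI impI)
  fix x :: "nat \<Rightarrow> real^'n" and a
  assume a: "a \<in> A" and x: "(\<forall>n. x n \<in> A) \<and> x \<longlonglongrightarrow> a"
  show "(E \<circ> x) \<longlonglongrightarrow> E a"
    unfolding comp_def E_def
  proof (rule integral_dominated_convergence[OF _ _ Y])
    show "AE \<theta>' in \<mu>. (\<lambda>n. exp (2 * ip (x n - h) (\<theta>' - h))) \<longlonglongrightarrow> exp (2 * ip (a - h) (\<theta>' - h))"
    proof (rule AE_I2)
      fix \<theta>'
      have "continuous_on UNIV (\<lambda>u. exp (2 * ip (u - h) (\<theta>' - h)))"
        by (intro continuous_intros)
      then show "(\<lambda>n. exp (2 * ip (x n - h) (\<theta>' - h))) \<longlonglongrightarrow> exp (2 * ip (a - h) (\<theta>' - h))"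
        using x by (auto intro: continuous_on_tendsto_compose simp del: ip_linear)
    qed
    show "AE \<theta>' in \<mu>. norm (exp (2 * ip (x n - h) (\<theta>' - h))) \<le> Y \<theta>'" for n
      using le[of "x n"] x by (simp del: ip_linear)
  qed measurable
qed

section \<open>Right derivative of the worst-case value\<close>

lemma ellipsoid_boundary_nonempty:
  assumes "0 \<le> r"
  shows "\<exists>u. q u = r"
proof -
  have "axis undefined 1 \<noteq> (0 :: real^'n)" by (simp add: axis_eq_0_iff)
  then obtain x :: "real^'n" where x: "0 < ip x x" using ip_pos by blast
  have "q (h + sqrt (r / ip x x) *\<^sub>R x) = r"
    using x assms by (simp add: mult.assoc[symmetric])
  then show ?thesis by blast
qed

text \<open>Finiteness of the supremum makes \<open>enn2real\<close> faithful, which would otherwise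
  send infinity to 0.\<close>

lemma F_sup_le:
  assumes t: "0 \<le> t" "t < 1"
  shows "(SUP u\<in>{u. q u \<le> r}. ennreal (F t u)) \<le> ennreal (exp r / (1 - t))"
proof (intro SUP_least ennreal_leI)
  fix u assume "u \<in> {u. q u \<le> r}"
  then have "exp (q u) / (1 - t) \<le> exp r / (1 - t)"
    using t by (intro divide_right_mono) auto
  with F_le[OF t, of u] show "F t u \<le> exp r / (1 - t)" by linarith
qed

lemma right_derivative_sup_F:
  assumes \<rho>: "0 \<le> \<rho>"
    and Y: "integrable \<mu> Y"
    and le: "\<And>u. q u = \<rho> \<Longrightarrow> AE \<theta>' in \<mu>. exp (2 * ip (u - h) (\<theta>' - h)) \<le> Y \<theta>'"
    and nz: "\<And>u. q u = \<rho> \<Longrightarrow> \<not> (AE \<theta>' in \<mu>. ip (u - h) (\<theta>' - h) = 0)"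
  defines "l \<equiv> (\<lambda>t. enn2real (SUP u\<in>{u. q u \<le> \<rho>}. ennreal (F t u)))"
  shows "\<exists>d<0. (\<forall>u. q u = \<rho> \<longrightarrow> G u \<le> d) \<and> (l has_real_derivative d) (at_right 0)"
proof -
  let ?K = "{u. q u \<le> \<rho>}" and ?S = "{u. q u = \<rho>}"
  have K: "compact ?K" by (rule compact_ellipsoid)
  have S: "compact ?S"
  proof -
    have "closed ?S" by (intro closed_Collect_eq continuous_intros)
    with K have "compact (?K \<inter> ?S)" by (rule compact_Int_closed)
    moreover have "?K \<inter> ?S = ?S" by (auto simp del: ip_linear)
    ultimately show ?thesis by simp
  qed
  have Sne: "?S \<noteq> {}" using ellipsoid_boundary_nonempty[OF \<rho>] by blast
  have ei: "exp_integrable u" if "q u = \<rho>" for u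
    unfolding exp_integrable_def
    by (rule Bochner_Integration.integrable_bound[OF Y])
      (use le[OF that] in \<open>auto elim!: eventually_mono simp del: ip_linear\<close>)
  \<comment> \<open>On the sphere \<open>exp (q u)\<close> is constant, so minimising
    \<open>E\<close> maximises \<open>G\<close>.\<close>
  obtain v where v: "q v = \<rho>" "\<And>u. q u = \<rho> \<Longrightarrow> E v \<le> E u"
    using continuous_attains_inf[OF S Sne continuous_E[OF Y]] le by blast
  define M where "M = exp \<rho>"
  define d where "d = G v"
  have d: "d = M * (1 - E v)" by (simp only: d_def G_eq[OF ei[OF v(1)]] v(1) M_def)
  have "d < 0" using E_gt_1[OF ei[OF v(1)] nz[OF v(1)]] by (simp add: d M_def mult_pos_neg)
  have G_le: "G u \<le> d" if "q u = \<rho>" for u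
    unfolding d G_eq[OF ei[OF that]] that M_def using v(2)[OF that] by simp
  have F0_le: "F 0 u \<le> M" if "u \<in> ?K" for u
    using that unfolding F_0 M_def by simp
  have l_upper: "l t \<le> B" if t: "0 \<le> t" "t < 1" and B: "\<And>u. u \<in> ?K \<Longrightarrow> F t u \<le> B" for t B
  proof -
    have "0 \<le> F t v" using t by (rule F_nonneg)
    \<comment> \<open>Needed because \<open>enn2real (ennreal B)\<close> is B only for nonnegative
      B.\<close>
    then have "0 \<le> B" using B[of v] v(1) by simp
    have "(SUP u\<in>?K. ennreal (F t u)) \<le> ennreal B"
      using B by (intro SUP_least ennreal_leI) auto
    from enn2real_mono[OF this] show ?thesis using \<open>0 \<le> B\<close> by (simp add: l_def)
  qed
  have l_lower: "F t u \<le> l t" if t: "0 \<le> t" "t < 1" and u: "u \<in> ?K" for t u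
  proof -
    have "(SUP u\<in>?K. ennreal (F t u)) \<le> ennreal (exp \<rho> / (1 - t))"
      using t by (rule F_sup_le)
    then have "(SUP u\<in>?K. ennreal (F t u)) < top" by (rule le_less_trans) simp
    moreover have "ennreal (F t u) \<le> (SUP u\<in>?K. ennreal (F t u))"
      using u by (rule SUP_upper)
    ultimately have "enn2real (ennreal (F t u)) \<le> l t"
      unfolding l_def by (intro enn2real_mono) auto
    then show ?thesis using F_nonneg[OF t] by simp
  qed
  have l0: "l 0 = M"
  proof (rule antisym)
    show "l 0 \<le> M" using F0_le by (intro l_upper) auto
    show "M \<le> l 0" using l_lower[of 0 v] v(1) by (simp add: F_0 M_def)
  qed
  have lower: "M + t * d \<le> l t" if "0 \<le> t" "t < 1" for t
    using F_tangent[OF ei[OF v(1)] that] l_lower[OF that, of v] v(1) by (simp add: M_def d_def)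
  have upper: "\<exists>r. 0 < r \<and> r < 1 \<and> (\<forall>t. 0 \<le> t \<longrightarrow> t \<le> r \<longrightarrow> l t \<le> M + t * D)" if D: "d < D" for D
  proof -
    have "\<exists>r. 0 < r \<and> r < 1 \<and> (\<forall>t u. 0 \<le> t \<longrightarrow> t \<le> r \<longrightarrow> u \<in> ?K \<longrightarrow> F t u \<le> M + t * D)"
    proof (rule convex_family_uniform_upper_bound[OF K])
      show "continuous_on ?K (F s)" if "0 < s" "s < 1" for s
        using that by (intro continuous_F) auto
      show "F t u \<le> (1 - t / s) * F 0 u + (t / s) * F s u"
        if "u \<in> ?K" "0 < s" "s < 1" "0 \<le> t" "t \<le> s" for u s t
        using that(2-) by (rule F_chord)
      show "F 0 u \<le> M" if "u \<in> ?K" for u using that by (rule F0_le)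
      show "\<exists>s. 0 < s \<and> s < 1 \<and> F s u < M + s * D" if u: "u \<in> ?K" for u
      proof (cases "q u = \<rho>")
        case True
        show ?thesis
          using F_slope[OF ei[OF True], of D] G_le[OF True] D unfolding True M_def by simp
      next
        case False
        \<comment> \<open>Off the sphere no moment bound is at hand; the strict gap below
          \<open>M\<close> absorbs both the growth allowed by \<open>F_le\<close> and a negative
          \<open>D\<close>.\<close>
        then have "exp (q u) < M" using u by (simp add: M_def del: ip_linear)
        have "((\<lambda>s. M + s * D - exp (q u) / (1 - s)) \<longlongrightarrow> M + 0 * D - exp (q u) / (1 - 0)) (at_right 0)"
          by (intro tendsto_intros) auto
        then have "\<forall>\<^sub>F s in at_right 0. 0 < M + s * D - exp (q u) / (1 - s)"
          using \<open>exp (q u) < M\<close> by (intro order_tendstoD(1)) (auto simp del: ip_linear)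
        moreover have "\<forall>\<^sub>F s in at_right (0::real). s \<in> {0<..<1}"
          by (rule eventually_at_right_real) simp
        ultimately have "\<forall>\<^sub>F s in at_right 0. 0 < s \<and> s < 1 \<and> F s u < M + s * D"
        proof eventually_elim
          case (elim s)
          then show ?case using F_le[of s u] by (auto simp del: ip_linear)
        qed
        then show ?thesis using eventually_happens'[OF trivial_limit_at_right_real] by blast
      qed
    qed
    then obtain r where r: "0 < r" "r < 1" "\<And>t u. 0 \<le> t \<Longrightarrow> t \<le> r \<Longrightarrow> u \<in> ?K \<Longrightarrow> F t u \<le> M + t * D"
      by blast
    have "l t \<le> M + t * D" if "0 \<le> t" "t \<le> r" for t
      using r that by (intro l_upper) auto
    then show ?thesis using r by blast
  qed
  have "((\<lambda>t. (l t - l 0) / (t - 0)) \<longlongrightarrow> d) (at_right 0)"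
  proof (rule order_tendstoI)
    fix D assume D: "d < D"
    \<comment> \<open>The midpoint turns the non-strict bound of \<open>upper\<close> into a strict
      one for \<open>D\<close>.\<close>
    obtain r where r: "0 < r" "r < 1" "\<And>t. 0 \<le> t \<Longrightarrow> t \<le> r \<Longrightarrow> l t \<le> M + t * ((d + D) / 2)"
      using upper[of "(d + D) / 2"] D by auto
    have "\<forall>\<^sub>F t in at_right 0. t \<in> {0<..<r}"
      using r(1) by (rule eventually_at_right_real)
    then show "\<forall>\<^sub>F t in at_right 0. (l t - l 0) / (t - 0) < D"
    proof (rule eventually_mono)
      fix t assume t: "t \<in> {0<..<r}"
      then have "l t \<le> M + t * ((d + D) / 2)" using r(3) by auto
      moreover have "t * ((d + D) / 2) < t * D"
        using t D by (intro mult_strict_left_mono) auto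
      ultimately have "l t - M < t * D" by linarith
      then show "(l t - l 0) / (t - 0) < D"
        using t by (simp add: l0 pos_divide_less_eq mult.commute)
    qed
  next
    fix D assume D: "D < d"
    have "\<forall>\<^sub>F t in at_right (0::real). t \<in> {0<..<1}"
      by (rule eventually_at_right_real) simp
    then show "\<forall>\<^sub>F t in at_right 0. D < (l t - l 0) / (t - 0)"
    proof (rule eventually_mono)
      fix t :: real assume t: "t \<in> {0<..<1}"
      then have "t * D < t * d" using D by (intro mult_strict_left_mono) auto
      moreover have "M + t * d \<le> l t" using t by (intro lower) auto
      ultimately have "t * D < l t - M" by linarith
      then show "D < (l t - l 0) / (t - 0)"
        using t by (simp add: l0 pos_less_divide_eq mult.commute)
    qed
  qed
  then have "(l has_real_derivative d) (at_right 0)"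
    by (simp add: has_field_derivative_iff)
  with \<open>d < 0\<close> G_le show ?thesis by blast
qed

text \<open>The divergence formula turns the constraint into \<open>exp (q u) - 1\<close> being at
  most the radius, and the containment hypothesis makes membership in \<open>\<Theta>\<close>
  automatic. A positive radius lets the comparison in \<open>ennreal\<close> be read in the
  reals.\<close>

lemma U_data_eq:
  fixes \<alpha> :: real and n :: nat
  defines "\<rho> \<equiv> ln (1 + chi_square_quantile CARD('n) (1 - \<alpha>) / real n)"
  assumes pos: "0 < chi_square_quantile CARD('n) (1 - \<alpha>) / real n"
    and sub: "confidence_ellipsoid \<alpha> n \<Sigma> h \<subseteq> \<Theta>"
  shows "U_data \<alpha> n \<Theta> \<Sigma> h = {u. q u \<le> \<rho>}"
proof -
  define c where "c = chi_square_quantile CARD('n) (1 - \<alpha>) / real n"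
  have iff: "exp (q u) - 1 \<le> c \<longleftrightarrow> q u \<le> \<rho>" for u
  proof -
    have "exp (q u) - 1 \<le> c \<longleftrightarrow> exp (q u) \<le> 1 + c" by linarith
    also have "\<dots> \<longleftrightarrow> q u \<le> ln (1 + c)" using pos[folded c_def] by (simp add: ln_ge_iff del: ip_linear)
    finally show ?thesis unfolding \<rho>_def c_def .
  qed
  have "ennreal (exp (q u) - 1) \<le> ennreal c \<longleftrightarrow> q u \<le> \<rho>" for u
    unfolding ennreal_le_iff[OF less_imp_le[OF pos[folded c_def]]] by (rule iff)
  moreover have "{u. q u \<le> \<rho>} \<subseteq> \<Theta>"
    using sub unfolding confidence_ellipsoid_def ellipsoid_eq \<rho>_def .
  ultimately show ?thesis
    unfolding U_data_def chi2_div_mvn c_def[symmetric] by blast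
qed

end

text \<open>The supremum is formed in \<open>ereal\<close>, so it exists without a boundedness
  condition, and finiteness of \<open>l_fun\<close> for t < 1 is part of the claim so that passing
  to real values before differentiating loses nothing.\<close>

theorem proposition4p3p2:
  fixes \<alpha> :: real and n :: nat
    and \<Sigma> :: "real^'d^'d" and \<Theta> :: "(real^'d) set" and \<theta>h :: "real^'d"
    and \<mu>prop :: "(real^'d) measure"
  assumes "0 < \<alpha>" and "\<alpha> < 1" and "1 \<le> n"
    and "sym_posdef \<Sigma>"
    and "open \<Theta>" and "convex \<Theta>" and "\<theta>h \<in> \<Theta>"
    and "confidence_ellipsoid \<alpha> n \<Sigma> \<theta>h \<subseteq> \<Theta>"
    and "distribution_on \<Theta> \<mu>prop"
    and "symmetrical_around \<Theta> \<mu>prop \<theta>h"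
    and "\<exists>Y :: real^'d \<Rightarrow> real. integrable \<mu>prop Y \<and>
           (\<forall>\<theta> \<in> Theta_star \<alpha> n \<Theta> \<Sigma> \<theta>h (return borel \<theta>h).
              AE \<theta>' in \<mu>prop. exp (2 * Y_var \<Sigma> \<theta>h \<theta> \<theta>') \<le> Y \<theta>')"
    and "\<forall>\<theta> \<in> Theta_star \<alpha> n \<Theta> \<Sigma> \<theta>h (return borel \<theta>h).
           \<not> (AE \<theta>' in \<mu>prop. Y_var \<Sigma> \<theta>h \<theta> \<theta>' = 0)"
  shows "(SUP \<theta> \<in> Theta_star \<alpha> n \<Theta> \<Sigma> \<theta>h (return borel \<theta>h).
            ereal (LINT y|lborel.
              (mvn_density \<Sigma> \<theta> y)\<^sup>2
              * ((LINT \<theta>':\<Theta>|return borel \<theta>h. mvn_density \<Sigma> \<theta>' y)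
                 - (LINT \<theta>':\<Theta>|\<mu>prop. mvn_density \<Sigma> \<theta>' y))
              / (mvn_density \<Sigma> \<theta>h y)\<^sup>2)) < 0
         \<and> (\<forall>t\<in>{0..<1}. l_fun \<alpha> n \<Theta> \<Sigma> \<theta>h (mix_measure t (return borel \<theta>h) \<mu>prop) < \<infinity>)
         \<and> (\<exists>d<0. ((\<lambda>t. enn2real (l_fun \<alpha> n \<Theta> \<Sigma> \<theta>h (mix_measure t (return borel \<theta>h) \<mu>prop)))
                    has_real_derivative d) (at_right 0))"
proof -
  interpret symmetric_mixing \<Sigma> \<Theta> \<theta>h \<mu>prop
    using assms by unfold_locales
  define c where "c = chi_square_quantile CARD('d) (1 - \<alpha>) / real n"
  define \<rho> where "\<rho> = ln (1 + c)"
  let ?S = "Theta_star \<alpha> n \<Theta> \<Sigma> \<theta>h (return borel \<theta>h)"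
  let ?U = "U_data \<alpha> n \<Theta> \<Sigma> \<theta>h"
  have Y_var: "Y_var \<Sigma> \<theta>h u \<theta>' = ip (u - \<theta>h) (\<theta>' - \<theta>h)" for u \<theta>'
    by (simp add: Y_var_def ip_def)
  \<comment> \<open>Phrased with \<open>U_data\<close> itself: its description as an ellipsoid
    requires \<open>0 < c\<close>, which is derived from this equivalence.\<close>
  have star: "u \<in> ?S \<longleftrightarrow> u \<in> ?U \<and> (\<forall>v\<in>?U. q v \<le> q u)" for u
    unfolding Theta_star_def is_arg_max_def L_fun_return
    by (auto simp: not_less ennreal_less_iff simp del: ip_linear)
  have pos: "0 < c"
  proof (rule ccontr)
    \<comment> \<open>Otherwise \<open>U_data\<close> and hence \<open>Theta_star\<close> collapse to the centre, where \<open>Y_var\<close> vanishes.\<close>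
    assume "\<not> 0 < c"
    then have z: "ennreal c = 0" by (simp add: ennreal_neg)
    have "u \<in> ?U \<longleftrightarrow> u \<in> \<Theta> \<and> q u \<le> 0" for u
      unfolding U_data_def chi2_div_mvn c_def[symmetric] z le_zero_eq ennreal_eq_0_iff
      by (simp del: ip_linear)
    then have "\<theta>h \<in> ?S" unfolding star using h by simp
    then show False using assms(12) by (auto simp: Y_var)
  qed
  then have \<rho>: "0 \<le> \<rho>" by (simp add: \<rho>_def)
  have U: "?U = {u. q u \<le> \<rho>}"
    using U_data_eq[of \<alpha> n] pos assms(8) by (simp only: c_def \<rho>_def)
  obtain Y where Y: "integrable \<mu>prop Y"
    "\<And>u. u \<in> ?S \<Longrightarrow> AE \<theta>' in \<mu>prop. exp (2 * ip (u - \<theta>h) (\<theta>' - \<theta>h)) \<le> Y \<theta>'"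
    using assms(11) unfolding Y_var by blast
  have S1: "u \<in> ?S" if "q u = \<rho>" for u
    unfolding star U using that by simp
  obtain d where d: "d < 0" "\<And>u. q u = \<rho> \<Longrightarrow> G u \<le> d"
    "((\<lambda>t. enn2real (SUP u\<in>{u. q u \<le> \<rho>}. ennreal (F t u))) has_real_derivative d) (at_right 0)"
    using right_derivative_sup_F[OF \<rho> Y(1) Y(2)[OF S1]] assms(12) S1 unfolding Y_var by blast
  have S2: "q u = \<rho>" if "u \<in> ?S" for u
  proof -
    obtain v where "q v = \<rho>" using ellipsoid_boundary_nonempty[OF \<rho>] by blast
    then show ?thesis using that unfolding star U by (auto intro: antisym simp del: ip_linear)
  qed
  have l: "l_fun \<alpha> n \<Theta> \<Sigma> \<theta>h (mix_measure t (return borel \<theta>h) \<mu>prop)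
      = (SUP u\<in>{u. q u \<le> \<rho>}. ennreal (F t u))" if "0 \<le> t" "t < 1" for t
    unfolding l_fun_def U L_fun_mix[OF that] ..
  have "(SUP \<theta>\<in>?S. ereal (LINT y|lborel. (p \<theta> y)\<^sup>2
              * ((LINT \<theta>':\<Theta>|return borel \<theta>h. p \<theta>' y) - (LINT \<theta>':\<Theta>|\<mu>prop. p \<theta>' y))
              / (p \<theta>h y)\<^sup>2)) \<le> ereal d"
    unfolding set_integral_m set_integral_return G_def[symmetric]
    using d(2) S2 by (intro SUP_least) auto
  also have "ereal d < 0" using d(1) by simp
  finally have 1: "(SUP \<theta>\<in>?S. ereal (LINT y|lborel. (p \<theta> y)\<^sup>2
              * ((LINT \<theta>':\<Theta>|return borel \<theta>h. p \<theta>' y) - (LINT \<theta>':\<Theta>|\<mu>prop. p \<theta>' y))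
              / (p \<theta>h y)\<^sup>2)) < 0" .
  have 2: "l_fun \<alpha> n \<Theta> \<Sigma> \<theta>h (mix_measure t (return borel \<theta>h) \<mu>prop) < \<infinity>" if "t \<in> {0..<1}" for t
  proof -
    have t: "0 \<le> t" "t < 1" using that by auto
    have "(SUP u\<in>{u. q u \<le> \<rho>}. ennreal (F t u)) \<le> ennreal (exp \<rho> / (1 - t))"
      using F_sup_le[OF t] .
    then show ?thesis unfolding l[OF t] by (rule le_less_trans) simp
  qed
  \<comment> \<open>The formula for \<open>l_fun\<close> holds only for 0 \<le> t < 1, and the
    transfer of the derivative uses agreement at 0 too; hence the passage to \<open>{0..}\<close>
    with radius 1.\<close>
  have "((\<lambda>t. enn2real (l_fun \<alpha> n \<Theta> \<Sigma> \<theta>h (mix_measure t (return borel \<theta>h) \<mu>prop)))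
      has_real_derivative d) (at 0 within {0..})"
  proof (rule has_field_derivative_transform_within[OF d(3)[folded at_within_Ici_at_right], of 1])
    fix t :: real assume "t \<in> {0..}" "dist t 0 < 1"
    then show "enn2real (SUP u\<in>{u. q u \<le> \<rho>}. ennreal (F t u))
        = enn2real (l_fun \<alpha> n \<Theta> \<Sigma> \<theta>h (mix_measure t (return borel \<theta>h) \<mu>prop))"
      by (subst l) auto
  qed simp_all
  then show ?thesis using 1 2 d(1) unfolding at_within_Ici_at_right by blast
qed

end
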